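(* Let $X$ be a real Banach space, let $A\subset X$ be a (nonempty) bounded subset and let $\mathcal U$ be a free ultrafilter on $\mathbb N$. Then $$\gamma(\operatorname{conv}(A)^{\mathcal U})\le4\,\gamma(A^{\mathcal U}).$$
   Context: $X^{\mathcal U}$ is the quotient of $\ell_\infty(X)$ by the subspace of those $(x_n)$ with $\lim_{n,\mathcal U}\|x_n\|=0$; for $K\subset X$ bounded, $K^{\mathcal U}\subset X^{\mathcal U}$ is the set of classes of sequences $(x_n)$ with $x_n\in K$ for all $n$. For a subset $B$ of a Banach space $Y$ (here $Y=X^{\mathcal U}$), $\gamma(B)=\inf\{\varepsilon>0:\overline B^{w^*}\subset Y+\varepsilon B_{Y^{**}}\}$, where $B$ and $Y$ are regarded inside $Y^{**}$ and the closure is weak$^*$ in $Y^{**}$. *)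

theory Defs
  imports "HOL-Analysis.Analysis"
begin

(* The ultrapower depends on the ultrafilter, which is a term, so it cannot be a type.
   Real normed spaces are therefore given by explicit carriers; zero and differences
   are obtained from addition and scaling. *)

record 'v nspace =
  vcarrier :: "'v set"
  vadd :: "'v \<Rightarrow> 'v \<Rightarrow> 'v"
  vscale :: "real \<Rightarrow> 'v \<Rightarrow> 'v"
  vnorm :: "'v \<Rightarrow> real"

(* Functionals are extensional, so that equality of functions is equality on the carrier. *)

definition functionals :: "'v nspace \<Rightarrow> ('v \<Rightarrow> real) set" where
  "functionals Y = {f \<in> extensional (vcarrier Y).
     (\<forall>x\<in>vcarrier Y. \<forall>y\<in>vcarrier Y. f (vadd Y x y) = f x + f y) \<and>
     (\<forall>c. \<forall>x\<in>vcarrier Y. f (vscale Y c x) = c * f x) \<and>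
     (\<exists>C. \<forall>x\<in>vcarrier Y. \<bar>f x\<bar> \<le> C * vnorm Y x)}"

definition unit_ball :: "'v nspace \<Rightarrow> 'v set" where
  "unit_ball Y = {x \<in> vcarrier Y. vnorm Y x \<le> 1}"

definition dual :: "'v nspace \<Rightarrow> ('v \<Rightarrow> real) nspace" where
  "dual Y =
     \<lparr>vcarrier = functionals Y,
      vadd = (\<lambda>f g. \<lambda>x\<in>vcarrier Y. f x + g x),
      vscale = (\<lambda>c f. \<lambda>x\<in>vcarrier Y. c * f x),
      vnorm = (\<lambda>f. SUP x\<in>unit_ball Y. \<bar>f x\<bar>)\<rparr>"

abbreviation bidual :: "'v nspace \<Rightarrow> (('v \<Rightarrow> real) \<Rightarrow> real) nspace" where
  "bidual Y \<equiv> dual (dual Y)"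

definition canonical_embedding :: "'v nspace \<Rightarrow> 'v \<Rightarrow> ('v \<Rightarrow> real) \<Rightarrow> real" where
  "canonical_embedding Y y = (\<lambda>f\<in>vcarrier (dual Y). f y)"

(* The weak* topology of the dual of Y: pointwise convergence on Y. *)

definition weak_star :: "'v nspace \<Rightarrow> ('v \<Rightarrow> real) topology" where
  "weak_star Y =
     subtopology (product_topology (\<lambda>_. euclideanreal) (vcarrier Y)) (vcarrier (dual Y))"

(* Meant for bounded B: then the set of admissible eps is nonempty, and the real-valued
   infimum is the genuine one. *)

definition gamma_wc :: "'v nspace \<Rightarrow> 'v set \<Rightarrow> real" where
  "gamma_wc Y B = Inf {\<epsilon>. \<epsilon> > 0 \<and>
     weak_star (dual Y) closure_of (canonical_embedding Y ` B) \<subseteq>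
       {vadd (bidual Y) (canonical_embedding Y y) (vscale (bidual Y) \<epsilon> \<psi>) | y \<psi>.
          y \<in> vcarrier Y \<and> \<psi> \<in> unit_ball (bidual Y)}}"

(* The quotient of a normed space by a subspace N, with the quotient norm. The summand from N
   in vscale is only needed for c = 0. *)

definition coset :: "'b::real_normed_vector set \<Rightarrow> 'b \<Rightarrow> 'b set" where
  "coset N x = {x + n | n. n \<in> N}"

definition quotient_space :: "'b::real_normed_vector set \<Rightarrow> 'b set nspace" where
  "quotient_space N =
     \<lparr>vcarrier = range (coset N),
      vadd = (\<lambda>S T. {s + t | s t. s \<in> S \<and> t \<in> T}),
      vscale = (\<lambda>c S. {c *\<^sub>R s + n | s n. s \<in> S \<and> n \<in> N}),
      vnorm = (\<lambda>S. INF s\<in>S. norm s)\<rparr>"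

lemma coset_add:
  assumes "subspace N"
  shows "vadd (quotient_space N) (coset N x) (coset N y) = coset N (x + y)"
proof -
  have "\<exists>n. s + t = x + y + n \<and> n \<in> N" if st: "s \<in> coset N x" "t \<in> coset N y" for s t
  proof -
    obtain m n where "s = x + m" "t = y + n" "m \<in> N" "n \<in> N"
      using st unfolding coset_def by blast
    then have "s + t = x + y + (m + n)" "m + n \<in> N"
      using subspace_add[OF assms] by (simp_all add: algebra_simps)
    then show ?thesis by blast
  qed
  moreover have "\<exists>s t. x + y + n = s + t \<and> s \<in> coset N x \<and> t \<in> coset N y" if "n \<in> N" for n
  proof -
    have "x + y + n = x + (y + n)" "x \<in> coset N x" "y + n \<in> coset N y"
      using that subspace_0[OF assms] unfolding coset_def by (simp_all add: add.assoc)
    then show ?thesis by blast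
  qed
  ultimately show ?thesis
    unfolding quotient_space_def by (simp add: coset_def[of N "x + y"]) blast
qed

lemma coset_scale:
  assumes "subspace N"
  shows "vscale (quotient_space N) c (coset N x) = coset N (c *\<^sub>R x)"
proof -
  have "\<exists>n. c *\<^sub>R s + m = c *\<^sub>R x + n \<and> n \<in> N" if st: "s \<in> coset N x" "m \<in> N" for s m
  proof -
    obtain k where "s = x + k" "k \<in> N"
      using st unfolding coset_def by blast
    then have "c *\<^sub>R s + m = c *\<^sub>R x + (c *\<^sub>R k + m)" "c *\<^sub>R k + m \<in> N"
      using st subspace_add[OF assms] subspace_scale[OF assms]
      by (simp_all add: scaleR_add_right add.assoc)
    then show ?thesis by blast
  qed
  moreover have "x \<in> coset N x"
    using subspace_0[OF assms] unfolding coset_def by simp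
  ultimately show ?thesis
    unfolding quotient_space_def by (simp add: coset_def[of N "c *\<^sub>R x"]) blast
qed

definition free_ultrafilter :: "'i filter \<Rightarrow> bool" where
  "free_ultrafilter U \<longleftrightarrow>
     U \<noteq> bot \<and>
     (\<forall>P. eventually P U \<or> eventually (\<lambda>i. \<not> P i) U) \<and>
     (\<forall>i. \<not> eventually (\<lambda>j. j = i) U)"

(* As nat is discrete, the bounded continuous functions from nat to 'a with the supremum norm
   are exactly the bounded sequences. *)

definition null_sequences :: "nat filter \<Rightarrow> (nat \<Rightarrow>\<^sub>C 'a::real_normed_vector) set" where
  "null_sequences U = {x. ((\<lambda>n. norm (apply_bcontfun x n)) \<longlongrightarrow> 0) U}"

lemma subspace_null_sequences: "subspace (null_sequences U)"
proof (rule subspaceI)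
  show "0 \<in> null_sequences U"
    by (simp add: null_sequences_def)
  show "x + y \<in> null_sequences U" if "x \<in> null_sequences U" "y \<in> null_sequences U" for x y
    using that tendsto_add[of "apply_bcontfun x" 0 U "apply_bcontfun y" 0]
    by (simp add: null_sequences_def tendsto_norm_zero_iff plus_bcontfun.rep_eq)
  show "c *\<^sub>R x \<in> null_sequences U" if "x \<in> null_sequences U" for c x
    using that tendsto_scaleR[of "\<lambda>_. c" c U "apply_bcontfun x" 0]
    by (simp add: null_sequences_def tendsto_norm_zero_iff scaleR_bcontfun.rep_eq)
qed

definition ultrapower :: "nat filter \<Rightarrow> (nat \<Rightarrow>\<^sub>C 'a::real_normed_vector) set nspace" where
  "ultrapower U = quotient_space (null_sequences U)"

definition set_ultrapower ::
  "nat filter \<Rightarrow> 'a::real_normed_vector set \<Rightarrow> (nat \<Rightarrow>\<^sub>C 'a) set set" where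
  "set_ultrapower U K = coset (null_sequences U) ` {x. \<forall>n. apply_bcontfun x n \<in> K}"

end

theory Submission
  imports Defs "HOL-Library.Ramsey"
begin

text \<open>
  Failure of weak compactness of \<open>A\<^sup>U\<close> is traced by finite configurations in \<open>X\<close>, and these pass from
  \<open>conv A\<close> to \<open>A\<close>. An \<open>\<epsilon>\<close>-separated system of length \<open>n\<close> in \<open>A\<close> consists of points \<open>x\<^sub>i\<close> of \<open>A\<close> and
  functionals \<open>f\<^sub>k\<close> of norm at most one on \<open>X\<close> such that \<open>f\<^sub>k(x\<^sub>l) - f\<^sub>k(x\<^sub>i) \<ge> \<epsilon>\<close> whenever
  \<open>i < k \<le> l < n\<close>. Three facts are proved about bounded sets.

  \<^item> If some weak-star limit point of \<open>A\<^sup>U\<close> is further than \<open>\<epsilon>\<close> from every vector of \<open>X\<^sup>U\<close>, then \<open>A\<close> contains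
    \<open>\<epsilon>'\<close>-separated systems of every length, for each \<open>\<epsilon>' < \<epsilon>\<close>
    (\<open>not_weakly_compact_separated_system\<close>). Points of \<open>A\<^sup>U\<close> are chosen successively close to the
    limit point in the weak-star sense, so that the convex hull of the later points stays at
    distance at least \<open>\<epsilon>'\<close> from the convex hull of the earlier ones. Finitely many such distances are visible
    in a single coordinate, where the Hahn-Banach theorem in \<open>X\<close> gives the functionals.

  \<^item> If \<open>A\<close> contains \<open>\<epsilon>\<close>-separated systems of every length and every weak-star limit point of \<open>A\<^sup>U\<close> is
    within \<open>\<delta>\<close> of some vector of \<open>X\<^sup>U\<close>, then \<open>\<epsilon> \<le> 2\<delta>\<close>
    (\<open>separated_system_not_weakly_compact\<close>). The ultraproduct of the systems is an infinite system in \<open>X\<^sup>U\<close>, and the two iterated limits of its matrix of values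
    differ by at least \<open>\<epsilon>\<close>, although both are within \<open>\<delta>\<close> of the value of the limit functional at one
    vector of \<open>X\<^sup>U\<close>.

  \<^item> If \<open>conv A\<close> contains \<open>\<epsilon>\<close>-separated systems of every length, then so does \<open>A\<close>, for each smaller
    positive constant (\<open>separated_system_convex_hull\<close>). A point of \<open>conv A\<close> is the barycentre of a finitely
    supported probability on \<open>A\<close>. By Ramsey's theorem the second moments of the functionals under
    these probabilities may be assumed almost constant, and then averages of the functionals over
    long blocks are almost equal, in the mean square of the \<open>i\<close>-th probability, for all blocks before
    \<open>i\<close>, and likewise for all blocks after \<open>i\<close>. So one point of \<open>A\<close> can be selected at which the block
    averages take nearly one value before \<open>i\<close> and nearly another, smaller by \<open>\<epsilon>\<close>, after \<open>i\<close>.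

  Together they give the inequality with the constant 2 in place of 4; the factor 2 comes from the
  second fact.
\<close>

section \<open>Linear functionals below sublinear ones\<close>

text \<open>
  Homogeneity is required only as an inequality, a form that infima inherit; equality follows by
  rescaling.
\<close>
definition sublinear :: "('a::real_vector \<Rightarrow> real) \<Rightarrow> bool" where
  "sublinear q \<longleftrightarrow> (\<forall>x y. q (x + y) \<le> q x + q y) \<and> (\<forall>c x. c > 0 \<longrightarrow> q (c *\<^sub>R x) \<le> c * q x)"

lemma sublinear_add: "sublinear q \<Longrightarrow> q (x + y) \<le> q x + q y"
  by (simp add: sublinear_def)

lemma sublinear_scale:
  assumes "sublinear q" "c > 0"
  shows "q (c *\<^sub>R x) = c * q x"
proof (rule antisym)
  show "q (c *\<^sub>R x) \<le> c * q x"
    using assms by (simp add: sublinear_def)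
  have "q (inverse c *\<^sub>R (c *\<^sub>R x)) \<le> inverse c * q (c *\<^sub>R x)"
    using assms unfolding sublinear_def by (meson inverse_positive_iff_positive)
  then show "c * q x \<le> q (c *\<^sub>R x)"
    using assms(2) by (simp add: field_simps)
qed

lemma sublinear_zero:
  assumes "sublinear q"
  shows "q 0 = 0"
  using sublinear_scale[OF assms, of 2 0] by simp

lemma sublinear_lower:
  assumes "sublinear q"
  shows "- q (- x) \<le> q x"
  using sublinear_add[OF assms, of x "- x"] sublinear_zero[OF assms] by simp

text \<open>
  Two members of a chain lie above a common third one, so that subadditivity survives the infimum.
\<close>
lemma sublinear_INF_chain:
  assumes "C \<noteq> {}" and sub: "\<And>q. q \<in> C \<Longrightarrow> sublinear q"
    and chain: "\<And>q r. q \<in> C \<Longrightarrow> r \<in> C \<Longrightarrow> q \<le> r \<or> r \<le> q"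
    and below: "\<And>x. bdd_below ((\<lambda>q. q x) ` C)"
  shows "sublinear (\<lambda>x. INF q\<in>C. q x)"
proof -
  let ?u = "\<lambda>x. INF q\<in>C. q x"
  have low: "?u x \<le> q x" if "q \<in> C" for q x
    using below that by (rule cINF_lower)
  have "?u (x + y) \<le> ?u x + ?u y" for x y
  proof -
    have "?u (x + y) \<le> q x + r y" if qr: "q \<in> C" "r \<in> C" for q r
    proof -
      obtain s where s: "s \<in> C" "s \<le> q" "s \<le> r"
        using chain[OF qr] qr by blast
      have "?u (x + y) \<le> s (x + y)"
        using low s by blast
      also have "\<dots> \<le> s x + s y"
        using sub s sublinear_add by blast
      also have "\<dots> \<le> q x + r y"
        using s by (simp add: le_fun_def add_mono)
      finally show ?thesis .
    qed
    then have "?u (x + y) - r y \<le> ?u x" if "r \<in> C" for r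
      using that by (intro cINF_greatest[OF assms(1)]) (simp add: algebra_simps)
    then have "?u (x + y) - ?u x \<le> ?u y"
      by (intro cINF_greatest[OF assms(1)]) (simp add: algebra_simps)
    then show ?thesis by simp
  qed
  moreover have "?u (c *\<^sub>R x) \<le> c * ?u x" if "c > 0" for c x
  proof -
    have "?u (c *\<^sub>R x) / c \<le> q x" if "q \<in> C" for q
      using low[OF that, of "c *\<^sub>R x"] sublinear_scale[OF sub[OF that] \<open>c > 0\<close>, of x] \<open>c > 0\<close>
      by (simp add: field_simps)
    then have "?u (c *\<^sub>R x) / c \<le> ?u x"
      by (intro cINF_greatest[OF assms(1)])
    then show ?thesis
      using \<open>c > 0\<close> by (simp add: field_simps)
  qed
  ultimately show ?thesis
    by (simp add: sublinear_def)
qed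

text \<open>
  The tilt of \<open>q\<close> along \<open>a\<close> is again sublinear and lies below \<open>q\<close>. A minimal sublinear functional
  therefore coincides with all its tilts, and the last inequality then makes it additive.
\<close>
lemma sublinear_tilt:
  fixes q :: "'a::real_vector \<Rightarrow> real" and a :: 'a
  assumes q: "sublinear q"
  defines "r \<equiv> \<lambda>x. INF t\<in>{0..}. q (x + t *\<^sub>R a) - t * q a"
  shows "sublinear r" and "r x \<le> q x" and "r x \<le> q (x + a) - q a"
proof -
  have scale: "q (t *\<^sub>R y) = t * q y" if "t \<ge> 0" for t y
    using that sublinear_scale[OF q] sublinear_zero[OF q] by (cases "t = 0") auto
  have bdd: "bdd_below ((\<lambda>t. q (x + t *\<^sub>R a) - t * q a) ` {0..})" for x
  proof (rule bdd_belowI2)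
    fix t :: real assume "t \<in> {0..}"
    then have "q (t *\<^sub>R a) = t * q a"
      by (simp add: scale)
    then show "- q (- x) \<le> q (x + t *\<^sub>R a) - t * q a"
      using sublinear_add[OF q, of "x + t *\<^sub>R a" "- x"] by simp
  qed
  have low: "r x \<le> q (x + t *\<^sub>R a) - t * q a" if "t \<ge> 0" for t x
    unfolding r_def using that by (intro cINF_lower[OF bdd]) auto
  have great: "b \<le> r x" if "\<And>t. t \<ge> 0 \<Longrightarrow> b \<le> q (x + t *\<^sub>R a) - t * q a" for b x
    unfolding r_def using that by (intro cINF_greatest) auto
  have "r (x + y) \<le> r x + r y" for x y
  proof -
    have "r (x + y) \<le> (q (x + s *\<^sub>R a) - s * q a) + (q (y + t *\<^sub>R a) - t * q a)"
      if "s \<ge> 0" "t \<ge> 0" for s t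
      using low[of "s + t" "x + y"] that sublinear_add[OF q, of "x + s *\<^sub>R a" "y + t *\<^sub>R a"]
      by (simp add: algebra_simps)
    then have "r (x + y) - (q (y + t *\<^sub>R a) - t * q a) \<le> r x" if "t \<ge> 0" for t
      using that by (intro great) (simp add: algebra_simps)
    then have "r (x + y) - r x \<le> r y"
      by (intro great) (simp add: algebra_simps)
    then show ?thesis by simp
  qed
  moreover have "r (c *\<^sub>R x) \<le> c * r x" if "c > 0" for c x
  proof -
    have "r (c *\<^sub>R x) / c \<le> q (x + t *\<^sub>R a) - t * q a" if "t \<ge> 0" for t
    proof -
      have "r (c *\<^sub>R x) \<le> q (c *\<^sub>R x + (c * t) *\<^sub>R a) - c * t * q a"
        using low \<open>c > 0\<close> that by simp
      also have "c *\<^sub>R x + (c * t) *\<^sub>R a = c *\<^sub>R (x + t *\<^sub>R a)"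
        by (simp add: algebra_simps)
      also have "q \<dots> = c * q (x + t *\<^sub>R a)"
        using \<open>c > 0\<close> by (simp add: scale)
      finally show ?thesis
        using \<open>c > 0\<close> by (simp add: field_simps)
    qed
    then have "r (c *\<^sub>R x) / c \<le> r x"
      by (rule great)
    then show ?thesis
      using \<open>c > 0\<close> by (simp add: field_simps)
  qed
  ultimately show "sublinear r"
    by (simp add: sublinear_def)
  show "r x \<le> q x" "r x \<le> q (x + a) - q a"
    using low[of 0 x] low[of 1 x] by simp_all
qed

text \<open>
  The Hahn-Banach theorem. Zorn's lemma is applied to sublinear functionals on the whole space,
  ordered downwards, instead of to partial linear functionals: minimal ones are linear.
\<close>
lemma sublinear_dominates_linear:
  fixes p :: "'a::real_vector \<Rightarrow> real"
  assumes p: "sublinear p"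
  obtains f where "linear f" "\<And>x. f x \<le> p x"
proof -
  define S where "S = {q. sublinear q \<and> q \<le> p}"
  have "\<exists>m\<in>S. \<forall>q\<in>S. q \<le> m \<longrightarrow> q = m"
  proof (rule predicate_Zorn)
    show "partial_order_on S (relation_of (\<lambda>q r. r \<le> q) S)"
      by (rule partial_order_on_relation_ofI) auto
    fix C assume C: "C \<in> Chains (relation_of (\<lambda>q r. r \<le> q) S)"
    then have CS: "C \<subseteq> S"
      by (auto simp: Chains_def relation_of_def)
    have chain: "q \<le> r \<or> r \<le> q" if "q \<in> C" "r \<in> C" for q r
      using C that by (auto simp: Chains_def relation_of_def)
    show "\<exists>u\<in>S. \<forall>q\<in>C. u \<le> q"
    proof (cases "C = {}")
      case True
      then show ?thesis
        using p by (auto simp: S_def)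
    next
      case False
      have bdd: "bdd_below ((\<lambda>q. q x) ` C)" for x
      proof (rule bdd_belowI2)
        fix q assume "q \<in> C"
        then have "sublinear q" "q (- x) \<le> p (- x)"
          using CS by (auto simp: S_def le_fun_def)
        then show "- p (- x) \<le> q x"
          using sublinear_lower[of q x] by simp
      qed
      have low: "(INF q\<in>C. q x) \<le> q x" if "q \<in> C" for q x
        using bdd that by (rule cINF_lower)
      obtain q where q: "q \<in> C"
        using False by blast
      have "sublinear (\<lambda>x. INF q\<in>C. q x)"
        using CS by (intro sublinear_INF_chain False bdd chain) (auto simp: S_def)
      moreover have "(\<lambda>x. INF q\<in>C. q x) \<le> p"
        using low[OF q] q CS by (force simp: S_def le_fun_def intro: order_trans)
      ultimately show ?thesis
        using low by (intro bexI[of _ "\<lambda>x. INF q\<in>C. q x"]) (auto simp: S_def le_fun_def)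
    qed
  qed
  then obtain m where m: "sublinear m" "m \<le> p" and min: "\<And>q. sublinear q \<Longrightarrow> q \<le> m \<Longrightarrow> q = m"
    unfolding S_def by (auto intro: order_trans)
  have add: "m (x + a) = m x + m a" for x a
  proof (rule antisym)
    show "m (x + a) \<le> m x + m a"
      using m(1) by (rule sublinear_add)
    have "(\<lambda>x. INF t\<in>{0..}. m (x + t *\<^sub>R a) - t * m a) = m"
      using sublinear_tilt(1,2)[OF m(1)] by (intro min) (auto simp: le_fun_def)
    then have "m x \<le> m (x + a) - m a"
      using sublinear_tilt(3)[OF m(1), of x a] by (simp add: fun_eq_iff)
    then show "m x + m a \<le> m (x + a)"
      by simp
  qed
  have neg: "m (- x) = - m x" for x
    using add[of x "- x"] sublinear_zero[OF m(1)] by simp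
  have "m (c *\<^sub>R x) = c * m x" for c x
  proof -
    consider "c > 0" | "c = 0" | "- c > 0" by linarith
    then show ?thesis
    proof cases
      case 3
      then show ?thesis
        using sublinear_scale[OF m(1) 3, of x] neg[of "c *\<^sub>R x"] by simp
    qed (use sublinear_scale[OF m(1)] sublinear_zero[OF m(1)] in auto)
  qed
  then have "linear m"
    using add by (intro linearI) auto
  then show thesis
    using m(2) that by (auto simp: le_fun_def)
qed

definition unit_functionals :: "('a::real_normed_vector \<Rightarrow> real) set" where
  "unit_functionals = {f. linear f \<and> (\<forall>x. \<bar>f x\<bar> \<le> norm x)}"

lemma unit_functionals_bound: "f \<in> unit_functionals \<Longrightarrow> norm x \<le> R \<Longrightarrow> \<bar>f x\<bar> \<le> R"
  unfolding unit_functionals_def by (blast intro: order_trans)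

text \<open>
  The functional \<open>p x = inf {norm (x + t c) - t d | t \<ge> 0, c \<in> C}\<close> is finite because \<open>C\<close> has distance
  at least \<open>d\<close> from the origin, is at most the norm, and is at most \<open>- d\<close> on \<open>- C\<close>. A linear functional below
  it inherits both bounds.
\<close>
lemma convex_away_from_zero_functional:
  fixes C :: "'a::real_normed_vector set"
  assumes "convex C" "C \<noteq> {}" and far: "\<And>c. c \<in> C \<Longrightarrow> d \<le> norm c"
  obtains f where "f \<in> unit_functionals" "\<And>c. c \<in> C \<Longrightarrow> d \<le> f c"
proof -
  define I where "I = {0::real..} \<times> C"
  define h where "h x i = norm (x + fst i *\<^sub>R snd i) - fst i * d" for x :: 'a and i :: "real \<times> 'a"
  define p where "p x = (INF i\<in>I. h x i)" for x
  have I: "I \<noteq> {}"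
    using assms(2) by (auto simp: I_def)
  have bdd: "bdd_below (h x ` I)" for x
  proof (rule bdd_belowI2)
    fix i assume "i \<in> I"
    then obtain t c where i: "i = (t, c)" "t \<ge> 0" "c \<in> C"
      by (auto simp: I_def)
    have "t * d \<le> t * norm c"
      using far i by (simp add: mult_left_mono)
    also have "\<dots> = norm (t *\<^sub>R c)"
      using i by simp
    also have "\<dots> \<le> norm (x + t *\<^sub>R c) + norm x"
      using norm_triangle_ineq4[of "x + t *\<^sub>R c" x] by simp
    finally show "- norm x \<le> h x i"
      by (simp add: h_def i)
  qed
  have low: "p x \<le> norm (x + t *\<^sub>R c) - t * d" if "t \<ge> 0" "c \<in> C" for x t c
    unfolding p_def using cINF_lower[OF bdd, of "(t, c)" x] that by (simp add: h_def I_def)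
  have great: "b \<le> p x" if "\<And>t c. t \<ge> 0 \<Longrightarrow> c \<in> C \<Longrightarrow> b \<le> norm (x + t *\<^sub>R c) - t * d" for b x
    unfolding p_def using that by (intro cINF_greatest I) (auto simp: h_def I_def)
  have "p (x + y) \<le> p x + p y" for x y
  proof -
    have "p (x + y) \<le> (norm (x + s *\<^sub>R b) - s * d) + (norm (y + t *\<^sub>R c) - t * d)"
      if st: "s \<ge> 0" "t \<ge> 0" "b \<in> C" "c \<in> C" for s t b c
    proof -
      have "\<exists>e\<in>C. (s + t) *\<^sub>R e = s *\<^sub>R b + t *\<^sub>R c"
      proof (cases "s + t = 0")
        case True
        then have "s = 0" "t = 0" using st by auto
        then show ?thesis using st by auto
      next
        case False
        then have "(s / (s + t)) *\<^sub>R b + (t / (s + t)) *\<^sub>R c \<in> C"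
          using st by (intro convexD[OF assms(1)]) (auto simp flip: add_divide_distrib)
        then show ?thesis
          using False by (intro bexI) (auto simp: scaleR_add_right)
      qed
      then obtain e where e: "e \<in> C" "(s + t) *\<^sub>R e = s *\<^sub>R b + t *\<^sub>R c" by blast
      have "p (x + y) \<le> norm (x + y + (s + t) *\<^sub>R e) - (s + t) * d"
        using e st by (intro low) auto
      also have "x + y + (s + t) *\<^sub>R e = (x + s *\<^sub>R b) + (y + t *\<^sub>R c)"
        by (simp add: e)
      also have "norm \<dots> \<le> norm (x + s *\<^sub>R b) + norm (y + t *\<^sub>R c)"
        by (rule norm_triangle_ineq)
      finally show ?thesis by (simp add: algebra_simps)
    qed
    note split = this
    have "p (x + y) - (norm (y + t *\<^sub>R c) - t * d) \<le> p x" if "t \<ge> 0" "c \<in> C" for t c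
    proof (rule great)
      fix s b assume "s \<ge> (0::real)" "b \<in> C"
      then show "p (x + y) - (norm (y + t *\<^sub>R c) - t * d) \<le> norm (x + s *\<^sub>R b) - s * d"
        using split[of s t b c] that by linarith
    qed
    then have "p (x + y) - p x \<le> norm (y + t *\<^sub>R c) - t * d" if "t \<ge> 0" "c \<in> C" for t c
      using that by (smt (verit))
    then have "p (x + y) - p x \<le> p y"
      by (rule great)
    then show ?thesis by simp
  qed
  moreover have "p (a *\<^sub>R x) \<le> a * p x" if "a > 0" for a x
  proof -
    have "p (a *\<^sub>R x) / a \<le> norm (x + t *\<^sub>R c) - t * d" if "t \<ge> 0" "c \<in> C" for t c
    proof -
      have "p (a *\<^sub>R x) \<le> norm (a *\<^sub>R x + (a * t) *\<^sub>R c) - a * t * d"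
        using that \<open>a > 0\<close> by (intro low) auto
      also have "a *\<^sub>R x + (a * t) *\<^sub>R c = a *\<^sub>R (x + t *\<^sub>R c)"
        by (simp add: algebra_simps)
      also have "norm \<dots> = a * norm (x + t *\<^sub>R c)"
        using \<open>a > 0\<close> by simp
      finally show ?thesis
        using \<open>a > 0\<close> by (simp add: field_simps)
    qed
    then have "p (a *\<^sub>R x) / a \<le> p x"
      by (rule great)
    then show ?thesis
      using \<open>a > 0\<close> by (simp add: field_simps)
  qed
  ultimately have "sublinear p"
    by (simp add: sublinear_def)
  then obtain f where f: "linear f" "\<And>x. f x \<le> p x"
    using sublinear_dominates_linear by blast
  have neg: "f (- x) = - f x" for x
    using f(1) by (rule linear_neg)
  have le: "f x \<le> norm x" for x
    using f(2)[of x] low[of 0 _ x] assms(2) by force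
  have "\<bar>f x\<bar> \<le> norm x" for x
    using le[of x] le[of "- x"] neg[of x] by simp
  moreover have "d \<le> f c" if "c \<in> C" for c
    using f(2)[of "- c"] low[of 1 c "- c"] that neg[of c] by simp
  ultimately show thesis
    using f(1) that by (auto simp: unit_functionals_def)
qed

section \<open>Almost constant restrictions of bounded functions\<close>

lemma finite_ramsey_colours:
  fixes C :: "'c set"
  assumes "finite C"
  shows "\<exists>N::nat. \<forall>f \<in> nsets {..<N} r \<rightarrow> C. \<exists>H\<in>nsets {..<N} h. \<exists>c. \<forall>X\<in>nsets H r. f X = c"
proof -
  obtain b where b: "bij_betw b C {0..<card C}"
    using ex_bij_betw_finite_nat[OF assms] by blast
  obtain N :: nat where N: "partn_lst {..<N} (replicate (card C) h) r"
    using ramsey_full by blast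
  have "\<exists>H\<in>nsets {..<N} h. \<exists>c. \<forall>X\<in>nsets H r. f X = c" if f: "f \<in> nsets {..<N} r \<rightarrow> C" for f
  proof -
    have "b \<circ> f \<in> nsets {..<N} r \<rightarrow> {..<length (replicate (card C) h)}"
      using f b by (force simp: bij_betw_def)
    then obtain i where i: "i < card C" "monochromatic {..<N} h r (b \<circ> f) i"
      using N unfolding partn_lst_def by (metis length_replicate nth_replicate)
    then obtain H where H: "H \<in> nsets {..<N} h" "(b \<circ> f) ` nsets H r \<subseteq> {i}"
      unfolding monochromatic_def by blast
    have "nsets H r \<subseteq> nsets {..<N} r"
      using H(1) by (intro nsets_mono) (auto simp: nsets_def)
    then have "f X = f Y" if "X \<in> nsets H r" "Y \<in> nsets H r" for X Y
    proof -
      have "f X \<in> C" "f Y \<in> C" "b (f X) = b (f Y)"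
        using f H(2) that \<open>nsets H r \<subseteq> _\<close> by (auto simp: image_subset_iff)
      then show ?thesis
        using b by (auto simp: bij_betw_def inj_on_def)
    qed
    then show ?thesis
      using H(1) by blast
  qed
  then show ?thesis by blast
qed

text \<open>
  The colour of a set records the cells of a grid of mesh \<open>\<eta>\<close> that contain its \<open>q\<close> values.
\<close>
lemma ramsey_almost_constant:
  fixes M \<eta> :: real and q r h :: nat
  assumes "\<eta> > 0"
  shows "\<exists>N::nat. \<forall>F. (\<forall>s<q. \<forall>X\<in>nsets {..<N} r. \<bar>F s X\<bar> \<le> M) \<longrightarrow>
    (\<exists>H\<in>nsets {..<N} h. \<forall>s<q. \<forall>X\<in>nsets H r. \<forall>Y\<in>nsets H r. \<bar>F s X - F s Y\<bar> \<le> \<eta>)"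
proof -
  define C where "C = PiE {..<q} (\<lambda>_. {\<lfloor>- M / \<eta>\<rfloor>..\<lfloor>M / \<eta>\<rfloor>})"
  have "finite C"
    unfolding C_def by (intro finite_PiE) auto
  then obtain N :: nat where
    N: "\<forall>f\<in>nsets {..<N} r \<rightarrow> C. \<exists>H\<in>nsets {..<N} h. \<exists>c. \<forall>X\<in>nsets H r. f X = c"
    using finite_ramsey_colours[of C r h] by auto
  show ?thesis
  proof (intro exI[of _ N] allI impI)
    fix F :: "nat \<Rightarrow> nat set \<Rightarrow> real"
    assume bound: "\<forall>s<q. \<forall>X\<in>nsets {..<N} r. \<bar>F s X\<bar> \<le> M"
    define col where "col X = (\<lambda>s\<in>{..<q}. \<lfloor>F s X / \<eta>\<rfloor>)" for X
    have "col X \<in> C" if X: "X \<in> nsets {..<N} r" for X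
    proof -
      have "\<lfloor>F s X / \<eta>\<rfloor> \<in> {\<lfloor>- M / \<eta>\<rfloor>..\<lfloor>M / \<eta>\<rfloor>}" if "s < q" for s
      proof -
        have "\<bar>F s X\<bar> \<le> M"
          using bound X that by blast
        then have "- M \<le> F s X" "F s X \<le> M"
          by linarith+
        then have "- M / \<eta> \<le> F s X / \<eta>" "F s X / \<eta> \<le> M / \<eta>"
          using assms by (intro divide_right_mono; simp)+
        then show ?thesis
          unfolding atLeastAtMost_iff by (intro conjI floor_mono)
      qed
      then show ?thesis
        unfolding col_def C_def by (intro restrict_PiE_iff[THEN iffD2] ballI) auto
    qed
    then obtain H c where H: "H \<in> nsets {..<N} h" and c: "\<And>X. X \<in> nsets H r \<Longrightarrow> col X = c"
      using N by (metis Pi_I)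
    have "\<bar>F s X - F s Y\<bar> \<le> \<eta>" if "s < q" "X \<in> nsets H r" "Y \<in> nsets H r" for s X Y
    proof -
      have "col X s = col Y s"
        using that c by simp
      then have "\<lfloor>F s X / \<eta>\<rfloor> = \<lfloor>F s Y / \<eta>\<rfloor>"
        using that by (simp add: col_def)
      then have "\<bar>F s X / \<eta> - F s Y / \<eta>\<bar> < 1"
        by linarith
      then have "\<bar>F s X - F s Y\<bar> / \<eta> < 1"
        using assms by (simp add: abs_divide flip: diff_divide_distrib)
      then show ?thesis
        using assms by simp
    qed
    then show "\<exists>H\<in>nsets {..<N} h. \<forall>s<q. \<forall>X\<in>nsets H r. \<forall>Y\<in>nsets H r. \<bar>F s X - F s Y\<bar> \<le> \<eta>"
      using H by blast
  qed
qed

lemma nsets_enumerate: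
  fixes H :: "nat set"
  assumes "H \<in> nsets A T"
  obtains e where "strict_mono_on {..<T} e" "e ` {..<T} \<subseteq> H"
proof
  have H: "finite H" "card H = T"
    using assms by (auto simp: nsets_def)
  show "strict_mono_on {..<T} (\<lambda>i. sorted_list_of_set H ! i)"
    using H sorted_wrt_nth_less[OF strict_sorted_list_of_set[of H]] by (intro strict_mono_onI) simp
  show "(\<lambda>i. sorted_list_of_set H ! i) ` {..<T} \<subseteq> H"
    using H nth_mem[of _ "sorted_list_of_set H"] by auto
qed

lemma almost_homogeneous_triples:
  fixes M \<eta> :: real and T q :: nat
  assumes "\<eta> > 0"
  shows "\<exists>N::nat. \<forall>F::nat \<Rightarrow> nat \<Rightarrow> nat \<Rightarrow> nat \<Rightarrow> real.
    (\<forall>s<q. \<forall>i j k. i < j \<longrightarrow> j < k \<longrightarrow> k < N \<longrightarrow> \<bar>F s i j k\<bar> \<le> M) \<longrightarrow>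
    (\<exists>e. strict_mono_on {..<T} e \<and> e ` {..<T} \<subseteq> {..<N} \<and>
      (\<forall>s<q. \<forall>i j k i' j' k'. i < j \<longrightarrow> j < k \<longrightarrow> k < T \<longrightarrow> i' < j' \<longrightarrow> j' < k' \<longrightarrow> k' < T \<longrightarrow>
         \<bar>F s (e i) (e j) (e k) - F s (e i') (e j') (e k')\<bar> \<le> \<eta>))"
proof -
  obtain N :: nat where N: "\<forall>F. (\<forall>s<q. \<forall>X\<in>nsets {..<N} 3. \<bar>F s X\<bar> \<le> M) \<longrightarrow>
    (\<exists>H\<in>nsets {..<N} T. \<forall>s<q. \<forall>X\<in>nsets H 3. \<forall>Y\<in>nsets H 3. \<bar>F s X - F s Y\<bar> \<le> \<eta>)"
    using ramsey_almost_constant[OF assms, of q 3 M T] ..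
  show ?thesis
  proof (intro exI[of _ N] allI impI)
    fix F :: "nat \<Rightarrow> nat \<Rightarrow> nat \<Rightarrow> nat \<Rightarrow> real"
    assume bound: "\<forall>s<q. \<forall>i j k. i < j \<longrightarrow> j < k \<longrightarrow> k < N \<longrightarrow> \<bar>F s i j k\<bar> \<le> M"
    define G where "G s X =
      F s (sorted_list_of_set X ! 0) (sorted_list_of_set X ! 1) (sorted_list_of_set X ! 2)" for s X
    have G: "G s {i, j, k} = F s i j k" if "i < j" "j < k" for s i j k
    proof -
      have "sorted_list_of_set {i, j, k} = [i, j, k]"
        using that by (intro strict_sorted_equal) auto
      then show ?thesis
        by (simp add: G_def eval_nat_numeral)
    qed
    have "\<forall>s<q. \<forall>X\<in>nsets {..<N} 3. \<bar>G s X\<bar> \<le> M"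
      using bound by (auto simp: ordered_nsets_3_eq G)
    then obtain H where H: "H \<in> nsets {..<N} T"
      and close: "\<forall>s<q. \<forall>X\<in>nsets H 3. \<forall>Y\<in>nsets H 3. \<bar>G s X - G s Y\<bar> \<le> \<eta>"
      using N by blast
    obtain e where e: "strict_mono_on {..<T} e" "e ` {..<T} \<subseteq> H"
      using H by (rule nsets_enumerate)
    have tri: "e i < e j \<and> e j < e k \<and> {e i, e j, e k} \<in> nsets H 3" if "i < j" "j < k" "k < T" for i j k
    proof -
      have "e i < e j" "e j < e k"
        using strict_mono_onD[OF e(1)] that by auto
      moreover have "e i \<in> H" "e j \<in> H" "e k \<in> H"
        using e(2) that by auto
      ultimately show ?thesis
        unfolding ordered_nsets_3_eq by blast
    qed
    have "\<bar>F s (e i) (e j) (e k) - F s (e i') (e j') (e k')\<bar> \<le> \<eta>"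
      if "s < q" "i < j" "j < k" "k < T" "i' < j'" "j' < k'" "k' < T" for s i j k i' j' k'
    proof -
      have "\<bar>G s {e i, e j, e k} - G s {e i', e j', e k'}\<bar> \<le> \<eta>"
        using close tri[of i j k] tri[of i' j' k'] that by blast
      then show ?thesis
        using G tri[of i j k] tri[of i' j' k'] that by simp
    qed
    moreover have "e ` {..<T} \<subseteq> {..<N}"
      using e(2) H by (auto simp: nsets_def)
    ultimately show "\<exists>e. strict_mono_on {..<T} e \<and> e ` {..<T} \<subseteq> {..<N} \<and>
      (\<forall>s<q. \<forall>i j k i' j' k'. i < j \<longrightarrow> j < k \<longrightarrow> k < T \<longrightarrow> i' < j' \<longrightarrow> j' < k' \<longrightarrow> k' < T \<longrightarrow>
         \<bar>F s (e i) (e j) (e k) - F s (e i') (e j') (e k')\<bar> \<le> \<eta>)"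
      using e(1) by (intro exI[of _ e]) simp
  qed
qed

text \<open>
  For one-element sets Ramsey's theorem is the pigeonhole principle.
\<close>
lemma almost_constant_subsequence:
  fixes M \<eta> :: real and q :: nat
  assumes "\<eta> > 0"
  shows "\<exists>m::nat. \<forall>c. (\<forall>i<m. \<bar>c i\<bar> \<le> M) \<longrightarrow>
    (\<exists>e. strict_mono_on {..<q} e \<and> e ` {..<q} \<subseteq> {..<m} \<and> (\<forall>i<q. \<forall>j<q. \<bar>c (e i) - c (e j)\<bar> \<le> \<eta>))"
proof -
  obtain m :: nat where m: "\<forall>F. (\<forall>s<1::nat. \<forall>X\<in>nsets {..<m} 1. \<bar>F s X\<bar> \<le> M) \<longrightarrow>
    (\<exists>H\<in>nsets {..<m} q. \<forall>s<1::nat. \<forall>X\<in>nsets H 1. \<forall>Y\<in>nsets H 1. \<bar>F s X - F s Y\<bar> \<le> \<eta>)"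
    using ramsey_almost_constant[OF assms, of 1 1 M q] ..
  show ?thesis
  proof (intro exI[of _ m] allI impI)
    fix c :: "nat \<Rightarrow> real" assume "\<forall>i<m. \<bar>c i\<bar> \<le> M"
    then have "\<forall>s<1. \<forall>X\<in>nsets {..<m} 1. \<bar>c (the_elem X)\<bar> \<le> M"
      by (auto simp: nsets_one)
    then have "\<exists>H\<in>nsets {..<m} q. \<forall>s<1::nat. \<forall>X\<in>nsets H 1. \<forall>Y\<in>nsets H 1.
        \<bar>c (the_elem X) - c (the_elem Y)\<bar> \<le> \<eta>"
      using m[rule_format, of "\<lambda>_ X. c (the_elem X)"] by blast
    then obtain H where H: "H \<in> nsets {..<m} q" "\<And>i j. i \<in> H \<Longrightarrow> j \<in> H \<Longrightarrow> \<bar>c i - c j\<bar> \<le> \<eta>"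
      by (auto simp: nsets_one)
    obtain e where e: "strict_mono_on {..<q} e" "e ` {..<q} \<subseteq> H"
      using H(1) by (rule nsets_enumerate)
    moreover have "e i \<in> H" if "i < q" for i
      using e(2) that by auto
    moreover have "e ` {..<q} \<subseteq> {..<m}"
      using e(2) H(1) by (auto simp: nsets_def)
    ultimately show "\<exists>e. strict_mono_on {..<q} e \<and> e ` {..<q} \<subseteq> {..<m} \<and>
      (\<forall>i<q. \<forall>j<q. \<bar>c (e i) - c (e j)\<bar> \<le> \<eta>)"
      using H(2) by (intro exI[of _ e]) simp
  qed
qed

section \<open>Separated systems in convex hulls\<close>

text \<open>
  A finite form of James's condition. No common threshold is prescribed: \<open>f k\<close> only has to jump by
  \<open>\<epsilon>\<close> across the cut before \<open>k\<close>.
\<close>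
definition separated_system :: "'a::real_normed_vector set \<Rightarrow> real \<Rightarrow> nat \<Rightarrow> bool" where
  "separated_system A \<epsilon> n \<longleftrightarrow> (\<exists>x f. (\<forall>i<n. x i \<in> A \<and> f i \<in> unit_functionals) \<and>
     (\<forall>i k l. i < k \<longrightarrow> k \<le> l \<longrightarrow> l < n \<longrightarrow> \<epsilon> \<le> f k (x l) - f k (x i)))"

definition convex_weights :: "'a set \<Rightarrow> 'a set \<Rightarrow> ('a \<Rightarrow> real) \<Rightarrow> bool" where
  "convex_weights A S u \<longleftrightarrow> finite S \<and> S \<subseteq> A \<and> (\<forall>y\<in>S. 0 \<le> u y) \<and> sum u S = 1"

definition average :: "'a set \<Rightarrow> ('a \<Rightarrow> real) \<Rightarrow> ('a \<Rightarrow> real) \<Rightarrow> real" where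
  "average S u \<phi> = (\<Sum>y\<in>S. u y * \<phi> y)"

lemma average_diff: "average S u (\<lambda>y. \<phi> y - \<psi> y) = average S u \<phi> - average S u \<psi>"
  by (simp add: average_def right_diff_distrib sum_subtractf)

lemma average_add: "average S u (\<lambda>y. \<phi> y + \<psi> y) = average S u \<phi> + average S u \<psi>"
  by (simp add: average_def distrib_left sum.distrib)

lemma average_cmult: "average S u (\<lambda>y. c * \<phi> y) = c * average S u \<phi>"
  by (simp add: average_def sum_distrib_left mult.left_commute)

lemma average_divide: "average S u (\<lambda>y. \<phi> y / c) = average S u \<phi> / c"
  by (simp add: average_def sum_divide_distrib)

lemma average_sum: "average S u (\<lambda>y. \<Sum>k\<in>K. \<phi> k y) = (\<Sum>k\<in>K. average S u (\<phi> k))"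
  unfolding average_def sum_distrib_left by (rule sum.swap)

lemma average_le:
  assumes "convex_weights A S u" "\<And>y. y \<in> A \<Longrightarrow> \<phi> y \<le> b"
  shows "average S u \<phi> \<le> b"
proof -
  have "average S u \<phi> \<le> (\<Sum>y\<in>S. u y * b)"
    unfolding average_def using assms
    by (intro sum_mono mult_left_mono) (auto simp: convex_weights_def)
  also have "\<dots> = b"
    using assms(1) by (simp add: convex_weights_def flip: sum_distrib_right)
  finally show ?thesis .
qed

lemma average_abs_le:
  assumes "convex_weights A S u" "\<And>y. y \<in> A \<Longrightarrow> \<bar>\<phi> y\<bar> \<le> b"
  shows "\<bar>average S u \<phi>\<bar> \<le> b"
proof -
  have "average S u \<phi> \<le> b"
    using assms by (intro average_le) (auto simp: abs_le_iff)
  moreover have "average S u (\<lambda>y. - 1 * \<phi> y) \<le> b"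
    using assms by (intro average_le) (auto simp: abs_le_iff)
  ultimately show ?thesis
    unfolding average_cmult by simp
qed

lemma average_attained:
  assumes "convex_weights A S u" "b \<le> average S u \<phi>"
  shows "\<exists>y\<in>A. b \<le> \<phi> y"
proof (rule ccontr)
  assume "\<not> ?thesis"
  then have less: "\<phi> y < b" if "y \<in> S" for y
    using assms(1) that by (auto simp: convex_weights_def not_le)
  have S: "finite S" "S \<noteq> {}"
    using assms(1) by (auto simp: convex_weights_def)
  have "average S u \<phi> \<le> Max (\<phi> ` S)"
    using assms(1) S by (intro average_le[of S]) (auto simp: convex_weights_def)
  also have "\<dots> < b"
    using S less by simp
  finally show False
    using assms(2) by simp
qed

text \<open>
  A point of the convex hull is a barycentre. Linear functionals cannot distinguish it from its
  representing weights, but the weights also integrate products of functionals.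
\<close>
lemma convex_hull_average:
  fixes A :: "'a::real_vector set"
  assumes "x \<in> convex hull A"
  obtains S u where "convex_weights A S u" "\<And>f. linear f \<Longrightarrow> average S u f = f x"
proof -
  obtain S u where S: "finite S" "S \<subseteq> A" "\<forall>y\<in>S. 0 \<le> u y" "sum u S = 1" "(\<Sum>v\<in>S. u v *\<^sub>R v) = x"
    using assms unfolding convex_hull_explicit by blast
  have "average S u f = f x" if f: "linear f" for f
    unfolding S(5)[symmetric] average_def linear_sum[OF f] linear_scale[OF f] by simp
  then show thesis
    using that[of S u] S by (simp add: convex_weights_def)
qed

text \<open>
  In the square of a mean of \<open>r\<close> functions the \<open>r\<close> diagonal products carry the weight \<open>1 / r\<^sup>2\<close> each, so
  that only the off-diagonal ones count in the limit.
\<close>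
lemma average_square_mean:
  fixes w :: "nat \<Rightarrow> 'a \<Rightarrow> real"
  assumes "r > 0" "\<kappa> \<ge> 0"
    and off: "\<And>a b. a < r \<Longrightarrow> b < r \<Longrightarrow> a \<noteq> b \<Longrightarrow> average S u (\<lambda>y. w a y * w b y) \<le> \<kappa>"
    and diag: "\<And>a. a < r \<Longrightarrow> average S u (\<lambda>y. w a y * w a y) \<le> D"
  shows "average S u (\<lambda>y. ((\<Sum>a<r. w a y) / real r)\<^sup>2) \<le> \<kappa> + D / real r"
proof -
  have "average S u (\<lambda>y. ((\<Sum>a<r. w a y) / real r)\<^sup>2) =
      (\<Sum>a<r. \<Sum>b<r. average S u (\<lambda>y. w a y * w b y)) / (real r)\<^sup>2"
    by (simp add: power_divide power2_eq_square sum_product average_divide average_sum)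
  also have "\<dots> \<le> (\<Sum>a<r. \<Sum>b<r. \<kappa> + (if a = b then D else 0)) / (real r)\<^sup>2"
  proof (intro divide_right_mono sum_mono)
    fix a b assume "a \<in> {..<r}" "b \<in> {..<r}"
    then show "average S u (\<lambda>y. w a y * w b y) \<le> \<kappa> + (if a = b then D else 0)"
      using off[of a b] diag[of a] assms(2) by (cases "a = b") auto
  qed simp
  also have "(\<Sum>a<r. \<Sum>b<r. \<kappa> + (if a = b then D else 0)) = (real r)\<^sup>2 * \<kappa> + real r * D"
    by (simp add: sum.distrib power2_eq_square algebra_simps)
  also have "\<dots> / (real r)\<^sup>2 = \<kappa> + D / real r"
    using assms(1) by (simp add: add_divide_distrib power2_eq_square)
  finally show ?thesis .
qed

lemma unit_functionals_mean:
  fixes f :: "nat \<Rightarrow> 'a::real_normed_vector \<Rightarrow> real"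
  assumes "r > 0" "\<And>a. a < r \<Longrightarrow> f a \<in> unit_functionals"
  shows "(\<lambda>v. (\<Sum>a<r. f a v) / real r) \<in> unit_functionals"
proof -
  have lin: "linear (f a)" "\<bar>f a v\<bar> \<le> norm v" if "a < r" for a v
    using assms(2)[OF that] by (auto simp: unit_functionals_def)
  have "linear (\<lambda>v. (\<Sum>a<r. f a v) / real r)"
    by (rule linearI)
       (simp_all add: lin linear_add linear_scale sum.distrib add_divide_distrib flip: sum_distrib_left)
  moreover have "\<bar>(\<Sum>a<r. f a v) / real r\<bar> \<le> norm v" for v
  proof -
    have "\<bar>\<Sum>a<r. f a v\<bar> \<le> (\<Sum>a<r. norm v)"
      using lin(2) by (intro order_trans[OF sum_abs] sum_mono) auto
    then show ?thesis
      using assms(1) by (simp add: abs_divide field_simps)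
  qed
  ultimately show ?thesis
    by (simp add: unit_functionals_def)
qed

text \<open>
  The functionals \<open>g k\<close> are means over blocks of \<open>r\<close> functionals of a very long system, and the \<open>i\<close>-th
  probability represents a point of the system whose index lies between the blocks \<open>i\<close> and \<open>i + 1\<close>.
  The system is first thinned out by Ramsey's theorem, so that the second moments
  \<open>E\<^sub>i (f\<^sub>j f\<^sub>k)\<close> with \<open>j \<noteq> k\<close> are almost equal for all \<open>j, k\<close> above \<open>i\<close>, and also for all \<open>j, k\<close> below \<open>i\<close>. For
  two blocks on the same side of \<open>i\<close>, the off-diagonal terms of \<open>E\<^sub>i ((g\<^sub>k - g\<^sub>l)\<^sup>2)\<close> then almost cancel.
  This replaces the passage to almost everywhere convergent convex combinations, as in the proof
  of Krein's theorem by dominated convergence, by a finite statement.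
\<close>
lemma separated_system_blocks:
  fixes A :: "'a::real_normed_vector set"
  assumes R: "\<And>a. a \<in> A \<Longrightarrow> norm a \<le> R" "R > 0" and \<kappa>: "\<kappa> > 0"
    and sep: "\<And>n. separated_system (convex hull A) \<epsilon> n"
  obtains S u g where
    "\<And>i. i < m \<Longrightarrow> convex_weights A (S i) (u i)"
    "\<And>k. k \<le> m \<Longrightarrow> g k \<in> unit_functionals"
    "\<And>i. i < m \<Longrightarrow> \<epsilon> - \<kappa> \<le> average (S i) (u i) (\<lambda>y. g i y - g (Suc i) y)"
    "\<And>i k l. i < m \<Longrightarrow> k \<le> m \<Longrightarrow> l \<le> m \<Longrightarrow> k \<le> i \<longleftrightarrow> l \<le> i \<Longrightarrow>
       average (S i) (u i) (\<lambda>y. (g k y - g l y)\<^sup>2) \<le> \<kappa>"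
proof -
  obtain r0 :: nat where r0: "8 * R\<^sup>2 / \<kappa> < real r0"
    using reals_Archimedean2 by blast
  define r where "r = Suc r0"
  have r: "r > 0" "4 * R\<^sup>2 / real r \<le> \<kappa> / 2"
    using r0 \<kappa> by (auto simp: r_def field_simps)
  \<comment> \<open>Block \<open>k\<close> occupies the positions \<open>b k 0, \<dots>, b k (r - 1)\<close> among \<open>0, \<dots>, T - 1\<close>, and \<open>t i\<close> lies
    between the blocks \<open>i\<close> and \<open>i + 1\<close>. Position 0 and position \<open>T - 1\<close> only complete pairs to triples.\<close>
  define T where "T = Suc (Suc m * Suc r)"
  define b where "b k a = Suc (k * Suc r + a)" for k a
  define t where "t i = Suc i * Suc r" for i
  have b_pos: "0 < b k a" for k a
    by (simp add: b_def)
  have b_less_t: "b k a < t i" if "k \<le> i" "a < r" for k a i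
    using mult_le_mono1[OF that(1), of "Suc r"] that(2) by (simp add: b_def t_def)
  have t_less_b: "t i < b k a" if "i < k" for k a i
    using mult_le_mono1[of "Suc i" k "Suc r"] that by (simp add: b_def t_def)
  have t_less: "t i < Suc m * Suc r" if "i < m" for i
    using that unfolding t_def by (intro mult_strict_right_mono) auto
  have b_less: "b k a < Suc m * Suc r" if "k \<le> m" "a < r" for k a
    using b_less_t[OF that] by (simp add: t_def)
  have b_inj: "b k a \<noteq> b l a'" if "k \<noteq> l" "a < r" "a' < r" for k l a a'
    using that b_less_t[of k k a] t_less_b[of k l a'] b_less_t[of l l a'] t_less_b[of l k a]
    by (metis less_asym' linorder_neqE_nat order_refl less_trans less_irrefl)
  have b_inj': "b k a \<noteq> b k a'" if "a \<noteq> a'" for k a a'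
    using that by (simp add: b_def)
  define \<eta> where "\<eta> = \<kappa> / 4"
  have \<eta>: "\<eta> > 0"
    using \<kappa> by (simp add: \<eta>_def)
  obtain N :: nat where N: "\<forall>F::nat \<Rightarrow> nat \<Rightarrow> nat \<Rightarrow> nat \<Rightarrow> real.
    (\<forall>s<3. \<forall>i j k. i < j \<longrightarrow> j < k \<longrightarrow> k < N \<longrightarrow> \<bar>F s i j k\<bar> \<le> R + R\<^sup>2) \<longrightarrow>
    (\<exists>e. strict_mono_on {..<T} e \<and> e ` {..<T} \<subseteq> {..<N} \<and>
      (\<forall>s<3. \<forall>i j k i' j' k'. i < j \<longrightarrow> j < k \<longrightarrow> k < T \<longrightarrow> i' < j' \<longrightarrow> j' < k' \<longrightarrow> k' < T \<longrightarrow>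
         \<bar>F s (e i) (e j) (e k) - F s (e i') (e j') (e k')\<bar> \<le> \<eta>))"
    using almost_homogeneous_triples[OF \<eta>, of 3 "R + R\<^sup>2" T] ..
  obtain x f where x: "\<And>i. i < N \<Longrightarrow> x i \<in> convex hull A"
    and f: "\<And>i. i < N \<Longrightarrow> f i \<in> unit_functionals"
    and fx: "\<And>i k l. i < k \<Longrightarrow> k \<le> l \<Longrightarrow> l < N \<Longrightarrow> \<epsilon> \<le> f k (x l) - f k (x i)"
    using sep[of N] unfolding separated_system_def by blast
  have "\<forall>i. \<exists>S u. i < N \<longrightarrow> convex_weights A S u \<and> (\<forall>f. linear f \<longrightarrow> average S u f = f (x i))"
    using convex_hull_average[OF x] by metis
  then obtain S u where w: "\<And>i. i < N \<Longrightarrow> convex_weights A (S i) (u i)"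
    and mean: "\<And>i f. i < N \<Longrightarrow> linear f \<Longrightarrow> average (S i) (u i) f = f (x i)"
    by metis
  have lin: "linear (f i)" if "i < N" for i
    using f[OF that] by (simp add: unit_functionals_def)
  have f_le: "\<bar>f i a\<bar> \<le> R" if "i < N" "a \<in> A" for i a
    using f[OF that(1)] R(1)[OF that(2)] by (rule unit_functionals_bound)
  have prod_le: "\<bar>f j a * f k a\<bar> \<le> R\<^sup>2" if "j < N" "k < N" "a \<in> A" for j k a
    using f_le[of j a] f_le[of k a] that unfolding abs_mult power2_eq_square
    by (intro mult_mono) auto
  \<comment> \<open>The value of \<open>f j\<close> at the lowest point of a triple is recorded as well: it is a value below the jump.\<close>
  define F where "F s i j k = (if s = 0 then average (S i) (u i) (\<lambda>y. f j y * f k y)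
    else if s = 1 then average (S k) (u k) (\<lambda>y. f i y * f j y) else f j (x i))" for s i j k :: nat
  have "\<bar>F s i j k\<bar> \<le> R + R\<^sup>2" if "i < j" "j < k" "k < N" for s i j k
  proof -
    have "\<bar>average (S i) (u i) (\<lambda>y. f j y * f k y)\<bar> \<le> R\<^sup>2"
      "\<bar>average (S k) (u k) (\<lambda>y. f i y * f j y)\<bar> \<le> R\<^sup>2"
      using that prod_le by (intro average_abs_le[OF w]; simp)+
    moreover have "\<bar>average (S i) (u i) (f j)\<bar> \<le> R"
      using that f_le by (intro average_abs_le[OF w]; simp)
    ultimately show ?thesis
      using that mean[of i "f j"] lin[of j] \<open>R > 0\<close> zero_le_power2[of R]
      by (auto simp: F_def)
  qed
  then obtain e where e: "strict_mono_on {..<T} e" "e ` {..<T} \<subseteq> {..<N}"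
    and hom: "\<forall>s<3. \<forall>i j k i' j' k'. i < j \<longrightarrow> j < k \<longrightarrow> k < T \<longrightarrow> i' < j' \<longrightarrow> j' < k' \<longrightarrow> k' < T \<longrightarrow>
         \<bar>F s (e i) (e j) (e k) - F s (e i') (e j') (e k')\<bar> \<le> \<eta>"
    using spec[OF N, of F] by auto
  have eN: "e i < N" if "i < T" for i
    using e(2) that by auto
  have e_less: "e i < e j" if "i < j" "j < T" for i j
    using strict_mono_onD[OF e(1)] that by auto
  define av where "av i = average (S (e i)) (u (e i))" for i
  define h where "h j = f (e j)" for j
  have above: "\<bar>av i (\<lambda>y. h j y * h k y) - av i (\<lambda>y. h j' y * h k' y)\<bar> \<le> \<eta>"
    if "i < j" "i < k" "j \<noteq> k" "j < T" "k < T" "i < j'" "i < k'" "j' \<noteq> k'" "j' < T" "k' < T"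
    for i j k j' k'
  proof -
    have *: "\<bar>av i (\<lambda>y. h j y * h k y) - av i (\<lambda>y. h j' y * h k' y)\<bar> \<le> \<eta>"
      if "i < j" "j < k" "k < T" "i < j'" "j' < k'" "k' < T" for j k j' k'
      using hom[rule_format, of 0 i j k i j' k'] that by (simp add: F_def av_def h_def)
    show ?thesis
      using *[of j k j' k'] *[of k j j' k'] *[of j k k' j'] *[of k j k' j'] that
      by (simp add: mult.commute nat_neq_iff) auto
  qed
  have below: "\<bar>av i (\<lambda>y. h j y * h k y) - av i (\<lambda>y. h j' y * h k' y)\<bar> \<le> \<eta>"
    if "j < i" "k < i" "j \<noteq> k" "i < T" "j' < i" "k' < i" "j' \<noteq> k'" for i j k j' k'
  proof -
    have *: "\<bar>av i (\<lambda>y. h j y * h k y) - av i (\<lambda>y. h j' y * h k' y)\<bar> \<le> \<eta>"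
      if "j < k" "k < i" "j' < k'" "k' < i" for j k j' k'
      using hom[rule_format, of 1 j k i j' k' i] that \<open>i < T\<close> by (simp add: F_def av_def h_def)
    show ?thesis
      using *[of j k j' k'] *[of k j j' k'] *[of j k k' j'] *[of k j k' j'] that
      by (simp add: mult.commute nat_neq_iff) auto
  qed
  \<comment> \<open>The jump of \<open>h j\<close> between the points 0 and \<open>i\<close> is compared with \<open>h j'\<close> at \<open>i\<close> through the triples
    \<open>(0, j, i)\<close> and \<open>(i, j', T - 1)\<close>.\<close>
  have gap: "\<epsilon> - \<eta> \<le> av i (h j) - av i (h j')" if "0 < j" "j < i" "i < j'" "j' < T - 1" for i j j'
  proof -
    have "i < T" "j < T"
      using that by linarith+
    then have "\<epsilon> \<le> h j (x (e i)) - h j (x (e 0))"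
      using fx[of "e 0" "e j" "e i"] e_less[of 0 j] e_less[of j i] eN[of i] that by (simp add: h_def)
    moreover have "\<bar>h j (x (e 0)) - h j' (x (e i))\<bar> \<le> \<eta>"
      using hom[rule_format, of 2 0 j i i j' "T - 1"] that by (simp add: F_def h_def)
    moreover have "av i (h j) = h j (x (e i))" "av i (h j') = h j' (x (e i))"
      using that eN lin mean by (simp_all add: av_def h_def)
    ultimately show ?thesis by linarith
  qed
  define g where "g k v = (\<Sum>a<r. h (b k a) v) / real r" for k v
  have T: "T - 1 = Suc m * Suc r" "\<And>i. i < Suc m * Suc r \<Longrightarrow> i < T"
    by (auto simp: T_def)
  show thesis
  proof (rule that[of "\<lambda>i. S (e (t i))" "\<lambda>i. u (e (t i))" g])
    show "convex_weights A (S (e (t i))) (u (e (t i)))" if "i < m" for i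
      using that by (intro w eN T(2) t_less)
    show "g k \<in> unit_functionals" if "k \<le> m" for k
      unfolding g_def using that r(1) by (intro unit_functionals_mean) (auto simp: h_def intro!: f eN T(2) b_less)
    show "\<epsilon> - \<kappa> \<le> average (S (e (t i))) (u (e (t i))) (\<lambda>y. g i y - g (Suc i) y)" if i: "i < m" for i
    proof -
      have "real r * (\<epsilon> - \<eta>) = (\<Sum>a<r. \<epsilon> - \<eta>)"
        by simp
      also have "\<dots> \<le> (\<Sum>a<r. av (t i) (h (b i a)) - av (t i) (h (b (Suc i) a)))"
      proof (rule sum_mono)
        fix a assume "a \<in> {..<r}"
        then show "\<epsilon> - \<eta> \<le> av (t i) (h (b i a)) - av (t i) (h (b (Suc i) a))"
          using i b_less[of "Suc i" a] T(1)
          by (intro gap b_pos b_less_t t_less_b) auto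
      qed
      also have "\<dots> = real r * av (t i) (\<lambda>y. g i y - g (Suc i) y)"
        using r(1) by (simp add: g_def av_def average_diff average_divide average_sum sum_subtractf
            flip: diff_divide_distrib)
      finally have "\<epsilon> - \<eta> \<le> av (t i) (\<lambda>y. g i y - g (Suc i) y)"
        using r(1) by simp
      then show ?thesis
        using \<kappa> by (simp add: \<eta>_def av_def)
    qed
    show "average (S (e (t i))) (u (e (t i))) (\<lambda>y. (g k y - g l y)\<^sup>2) \<le> \<kappa>"
      if i: "i < m" and kl: "k \<le> m" "l \<le> m" "k \<le> i \<longleftrightarrow> l \<le> i" for i k l
    proof (cases "k = l")
      case True
      then show ?thesis
        using \<kappa> by (simp add: average_def)
    next
      case False
      let ?w = "\<lambda>a y. h (b k a) y - h (b l a) y"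
      define P where "P = (\<lambda>a. b k a) ` {..<r} \<union> (\<lambda>a. b l a) ` {..<r}"
      have close: "\<bar>av (t i) (\<lambda>y. h p y * h q y) - av (t i) (\<lambda>y. h p' y * h q' y)\<bar> \<le> \<eta>"
        if "p \<in> P" "q \<in> P" "p' \<in> P" "q' \<in> P" "p \<noteq> q" "p' \<noteq> q'" for p q p' q'
      proof (cases "k \<le> i")
        case True
        then have "p < t i" if "p \<in> P" for p
          using that kl b_less_t by (auto simp: P_def)
        then show ?thesis
          using that T(2) t_less[OF i] by (intro below) auto
      next
        case False
        then have "t i < p" "p < T" if "p \<in> P" for p
          using that kl t_less_b b_less T(2) by (auto simp: P_def)
        then show ?thesis
          using that by (intro above) auto
      qed
      have "average (S (e (t i))) (u (e (t i))) (\<lambda>y. ((\<Sum>a<r. ?w a y) / real r)\<^sup>2)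
          \<le> \<kappa> / 2 + 4 * R\<^sup>2 / real r"
      proof (rule average_square_mean[OF r(1)])
        show "0 \<le> \<kappa> / 2"
          using \<kappa> by simp
        fix a assume a: "a < r"
        have N: "e (b k a) < N" "e (b l a) < N"
          using a kl by (auto intro!: eN T(2) b_less)
        have "?w a y * ?w a y \<le> 4 * R\<^sup>2" if "y \<in> A" for y
        proof -
          have "\<bar>?w a y\<bar> \<le> 2 * R"
            using f_le[OF N(1) that] f_le[OF N(2) that] by (simp add: h_def)
          then have "(?w a y)\<^sup>2 \<le> (2 * R)\<^sup>2"
            using abs_le_square_iff[of "?w a y" "2 * R"] \<open>R > 0\<close> by simp
          then show ?thesis
            by (simp add: power2_eq_square)
        qed
        then show "average (S (e (t i))) (u (e (t i))) (\<lambda>y. ?w a y * ?w a y) \<le> 4 * R\<^sup>2"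
          using i by (intro average_le[OF w]) (auto intro!: eN T(2) t_less)
        fix a' assume a': "a' < r" "a \<noteq> a'"
        let ?Q = "\<lambda>p q. av (t i) (\<lambda>y. h p y * h q y)"
        have P: "b k a \<in> P" "b k a' \<in> P" "b l a \<in> P" "b l a' \<in> P"
          using a a' by (auto simp: P_def)
        have ne: "b k a \<noteq> b k a'" "b l a \<noteq> b l a'" "b k a \<noteq> b l a'" "b l a \<noteq> b k a'"
          using a a' False b_inj b_inj' by metis+
        have "?Q (b k a) (b k a') - ?Q (b k a) (b l a') \<le> \<eta>"
          using close[OF P(1,2) P(1,4) ne(1,3)] by linarith
        moreover have "?Q (b l a) (b l a') - ?Q (b l a) (b k a') \<le> \<eta>"
          using close[OF P(3,4) P(3,2) ne(2,4)] by linarith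
        moreover have "average (S (e (t i))) (u (e (t i))) (\<lambda>y. ?w a y * ?w a' y) =
            (?Q (b k a) (b k a') - ?Q (b k a) (b l a')) + (?Q (b l a) (b l a') - ?Q (b l a) (b k a'))"
          unfolding av_def average_diff[symmetric] average_add[symmetric]
          by (simp add: algebra_simps)
        ultimately show "average (S (e (t i))) (u (e (t i))) (\<lambda>y. ?w a y * ?w a' y) \<le> \<kappa> / 2"
          by (simp add: \<eta>_def)
      qed
      then show ?thesis
        using r(2) by (simp add: g_def sum_subtractf diff_divide_distrib)
    qed
  qed
qed

text \<open>
  The average of \<open>g\<^sub>i - g\<^sub>i\<^sub>+\<^sub>1\<close> minus a large multiple of the squared deviations stays above \<open>\<epsilon> - \<eta>\<close>, and
  so does its value at some point of \<open>A\<close>. There all deviations must be small, because the first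
  difference is bounded.
\<close>
lemma separated_system_selection:
  fixes A :: "'a::real_normed_vector set"
  assumes R: "\<And>a. a \<in> A \<Longrightarrow> norm a \<le> R" "R > 0" and \<eta>: "\<eta> > 0" "\<eta> \<le> \<epsilon>"
    and sep: "\<And>n. separated_system (convex hull A) \<epsilon> n"
  obtains y g where
    "\<And>i. i < m \<Longrightarrow> y i \<in> A"
    "\<And>k. k \<le> m \<Longrightarrow> g k \<in> unit_functionals"
    "\<And>i. i < m \<Longrightarrow> \<epsilon> - \<eta> \<le> g i (y i) - g (Suc i) (y i)"
    "\<And>i k. i < m \<Longrightarrow> k \<le> i \<Longrightarrow> \<bar>g k (y i) - g i (y i)\<bar> \<le> \<eta>"
    "\<And>i k. i < m \<Longrightarrow> i < k \<Longrightarrow> k \<le> m \<Longrightarrow> \<bar>g k (y i) - g (Suc i) (y i)\<bar> \<le> \<eta>"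
proof -
  \<comment> \<open>The factor \<open>K\<close> forces deviations at most \<open>\<eta>\<close>; \<open>\<kappa>\<close> is chosen such that the loss \<open>\<kappa>\<close> in the gap and
    the penalty for at most \<open>m + 1\<close> deviations add up to \<open>\<eta>\<close>.\<close>
  define K where "K = 2 * R / \<eta>\<^sup>2"
  have K: "K > 0"
    using R(2) \<eta> by (simp add: K_def)
  define \<kappa> where "\<kappa> = \<eta> / (1 + K * real (Suc m))"
  have pos: "1 + K * real (Suc m) > 0"
    using K by (intro add_pos_nonneg) auto
  have \<kappa>: "\<kappa> > 0" "\<kappa> + K * (real (Suc m) * \<kappa>) = \<eta>"
  proof -
    show "\<kappa> > 0"
      using \<eta>(1) pos by (simp add: \<kappa>_def)
    have "\<kappa> * (1 + K * real (Suc m)) = \<eta>"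
      using pos by (simp add: \<kappa>_def)
    then show "\<kappa> + K * (real (Suc m) * \<kappa>) = \<eta>"
      by (simp add: algebra_simps)
  qed
  obtain S u g where w: "\<And>i. i < m \<Longrightarrow> convex_weights A (S i) (u i)"
    and g: "\<And>k. k \<le> m \<Longrightarrow> g k \<in> unit_functionals"
    and gap: "\<And>i. i < m \<Longrightarrow> \<epsilon> - \<kappa> \<le> average (S i) (u i) (\<lambda>y. g i y - g (Suc i) y)"
    and sq: "\<And>i k l. i < m \<Longrightarrow> k \<le> m \<Longrightarrow> l \<le> m \<Longrightarrow> k \<le> i \<longleftrightarrow> l \<le> i \<Longrightarrow>
       average (S i) (u i) (\<lambda>y. (g k y - g l y)\<^sup>2) \<le> \<kappa>"
    using separated_system_blocks[OF R \<kappa>(1) sep, of m] by blast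
  define good where "good i y \<longleftrightarrow> y \<in> A \<and> \<epsilon> - \<eta> \<le> g i y - g (Suc i) y \<and>
      (\<forall>k\<le>i. \<bar>g k y - g i y\<bar> \<le> \<eta>) \<and>
      (\<forall>k. i < k \<longrightarrow> k \<le> m \<longrightarrow> \<bar>g k y - g (Suc i) y\<bar> \<le> \<eta>)" for i y
  have "\<exists>y. good i y" if i: "i < m" for i
  proof -
    define P where "P y = (\<Sum>k\<le>i. (g k y - g i y)\<^sup>2) + (\<Sum>k\<in>{i<..m}. (g k y - g (Suc i) y)\<^sup>2)" for y
    have "average (S i) (u i) P \<le> (\<Sum>k\<le>i. \<kappa>) + (\<Sum>k\<in>{i<..m}. \<kappa>)"
      unfolding P_def average_add average_sum using i by (intro add_mono sum_mono sq) auto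
    also have "\<dots> = real (Suc m) * \<kappa>"
      using i by (simp add: of_nat_diff algebra_simps)
    finally have "K * average (S i) (u i) P \<le> K * (real (Suc m) * \<kappa>)"
      using K by (intro mult_left_mono) auto
    then have "\<epsilon> - \<eta> \<le> average (S i) (u i) (\<lambda>y. (g i y - g (Suc i) y) - K * P y)"
      unfolding average_diff[of _ _ "\<lambda>y. g i y - g (Suc i) y"] average_cmult
      using gap[OF i] \<kappa>(2) by linarith
    then obtain y where y: "y \<in> A" "\<epsilon> - \<eta> \<le> (g i y - g (Suc i) y) - K * P y"
      using average_attained[OF w[OF i]] by blast
    have P: "0 \<le> P y" "\<And>k. k \<le> i \<Longrightarrow> (g k y - g i y)\<^sup>2 \<le> P y"
      "\<And>k. i < k \<Longrightarrow> k \<le> m \<Longrightarrow> (g k y - g (Suc i) y)\<^sup>2 \<le> P y"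
    proof -
      have nonneg: "0 \<le> (\<Sum>k\<le>i. (g k y - g i y)\<^sup>2)" "0 \<le> (\<Sum>k\<in>{i<..m}. (g k y - g (Suc i) y)\<^sup>2)"
        by (simp_all add: sum_nonneg)
      show "0 \<le> P y"
        using nonneg by (simp add: P_def)
      show "(g k y - g i y)\<^sup>2 \<le> P y" if "k \<le> i" for k
        using member_le_sum[of k "{..i}" "\<lambda>k. (g k y - g i y)\<^sup>2"] that nonneg by (simp add: P_def)
      show "(g k y - g (Suc i) y)\<^sup>2 \<le> P y" if "i < k" "k \<le> m" for k
        using member_le_sum[of k "{i<..m}" "\<lambda>k. (g k y - g (Suc i) y)\<^sup>2"] that nonneg
        by (simp add: P_def)
    qed
    have "\<bar>g i y\<bar> \<le> R" "\<bar>g (Suc i) y\<bar> \<le> R"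
      using i by (simp_all add: unit_functionals_bound[OF g R(1)[OF y(1)]])
    then have "K * P y \<le> 2 * R"
      using y(2) \<eta>(2) by linarith
    also have "2 * R = K * \<eta>\<^sup>2"
      using \<eta>(1) by (simp add: K_def)
    finally have "P y \<le> \<eta>\<^sup>2"
      using K by simp
    then have "\<bar>s\<bar> \<le> \<eta>" if "s\<^sup>2 \<le> P y" for s
      using that \<eta>(1) abs_le_square_iff[of s \<eta>] by simp
    moreover have "0 \<le> K * P y"
      using K P(1) by simp
    ultimately show ?thesis
      using y P(2,3) unfolding good_def by (intro exI[of _ y]) auto
  qed
  then obtain y where y: "\<And>i. i < m \<Longrightarrow> good i (y i)"
    by metis
  show thesis
    by (rule that[of y g]) (use y g in \<open>auto simp: good_def\<close>)
qed

text \<open>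
  At the selected point \<open>y i\<close> the functionals \<open>g k\<close> drop by almost \<open>\<epsilon>\<close> when \<open>k\<close> passes \<open>i\<close>, down to a level
  that may depend on \<open>i\<close>. On a subsequence these levels almost agree, and the jump between two points
  under one functional is then as large as the drop.
\<close>
lemma separated_system_convex_hull:
  fixes A :: "'a::real_normed_vector set"
  assumes "bounded A" and \<eta>: "\<eta> > 0" "\<eta> \<le> \<epsilon>"
    and sep: "\<And>n. separated_system (convex hull A) \<epsilon> n"
  shows "separated_system A (\<epsilon> - 4 * \<eta>) q"
proof -
  obtain R where R: "R > 0" "\<And>a. a \<in> A \<Longrightarrow> norm a \<le> R"
    using assms(1) unfolding bounded_pos by blast
  obtain m :: nat where m: "\<forall>c. (\<forall>i<m. \<bar>c i\<bar> \<le> R) \<longrightarrow>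
    (\<exists>e. strict_mono_on {..<q} e \<and> e ` {..<q} \<subseteq> {..<m} \<and> (\<forall>i<q. \<forall>j<q. \<bar>c (e i) - c (e j)\<bar> \<le> \<eta>))"
    using almost_constant_subsequence[OF \<eta>(1), where M = R and q = q] ..
  obtain y g where y: "\<And>i. i < m \<Longrightarrow> y i \<in> A"
    and g: "\<And>k. k \<le> m \<Longrightarrow> g k \<in> unit_functionals"
    and gap: "\<And>i. i < m \<Longrightarrow> \<epsilon> - \<eta> \<le> g i (y i) - g (Suc i) (y i)"
    and low: "\<And>i k. i < m \<Longrightarrow> k \<le> i \<Longrightarrow> \<bar>g k (y i) - g i (y i)\<bar> \<le> \<eta>"
    and high: "\<And>i k. i < m \<Longrightarrow> i < k \<Longrightarrow> k \<le> m \<Longrightarrow> \<bar>g k (y i) - g (Suc i) (y i)\<bar> \<le> \<eta>"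
    using separated_system_selection[OF R(2,1) \<eta> sep, of m] by blast
  have "\<bar>g (Suc i) (y i)\<bar> \<le> R" if "i < m" for i
    using that by (simp add: unit_functionals_bound[OF g R(2)[OF y]])
  then obtain e where e: "strict_mono_on {..<q} e" "e ` {..<q} \<subseteq> {..<m}"
    and const: "\<And>i j. i < q \<Longrightarrow> j < q \<Longrightarrow> \<bar>g (Suc (e i)) (y (e i)) - g (Suc (e j)) (y (e j))\<bar> \<le> \<eta>"
    using spec[OF m, of "\<lambda>i. g (Suc i) (y i)"] by auto
  have em: "e i < m" if "i < q" for i
    using e(2) that by auto
  have "\<epsilon> - 4 * \<eta> \<le> g (e k) (y (e l)) - g (e k) (y (e i))" if "i < k" "k \<le> l" "l < q" for i k l
  proof -
    have "e i < e k" "e k \<le> e l"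
      using strict_mono_onD[OF e(1), of i k] strict_mono_on_leD[OF e(1), of k l] that by auto
    then show ?thesis
      using gap[of "e l"] low[of "e l" "e k"] high[of "e i" "e k"] const[of l i] em[of i] em[of k] em[of l] that
      by (simp add: abs_le_iff)
  qed
  then show ?thesis
    unfolding separated_system_def using y g em
    by (intro exI[of _ "\<lambda>i. y (e i)"] exI[of _ "\<lambda>i. g (e i)"]) (simp add: less_imp_le)
qed

section \<open>Functionals on the ultrapower\<close>

lemma ultrafilter_convergent:
  fixes r :: "'i \<Rightarrow> real"
  assumes U: "free_ultrafilter U" and bound: "\<And>i. \<bar>r i\<bar> \<le> M"
  shows "(r \<longlongrightarrow> Lim U r) U"
proof -
  have ne: "U \<noteq> bot" and ultra: "eventually P U \<or> eventually (\<lambda>i. \<not> P i) U" for P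
    using U by (auto simp: free_ultrafilter_def)
  have "filtermap r U \<noteq> bot" "eventually (\<lambda>x. x \<in> {-M..M}) (filtermap r U)"
    using ne bound by (auto simp: filtermap_bot_iff eventually_filtermap abs_le_iff minus_le_iff)
  then obtain L where L: "inf (nhds L) (filtermap r U) \<noteq> bot"
    using compact_Icc[of "- M" M] unfolding compact_filter by blast
  have "(r \<longlongrightarrow> L) U"
  proof (rule topological_tendstoI)
    fix S assume S: "open S" "L \<in> S"
    show "eventually (\<lambda>i. r i \<in> S) U"
    proof (rule ccontr)
      assume "\<not> ?thesis"
      then have "eventually (\<lambda>x. x \<notin> S) (filtermap r U)"
        using ultra[of "\<lambda>i. r i \<in> S"] by (simp add: eventually_filtermap)
      moreover have "eventually (\<lambda>x. x \<in> S) (nhds L)"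
        using S by (rule eventually_nhds_in_open)
      ultimately have "eventually (\<lambda>x. False) (inf (nhds L) (filtermap r U))"
        unfolding eventually_inf by blast
      then show False
        using L by (simp add: trivial_limit_def)
    qed
  qed
  then show ?thesis
    using tendsto_Lim[OF ne] by metis
qed

lemma free_ultrafilter_gt:
  assumes "free_ultrafilter (U :: nat filter)"
  shows "eventually (\<lambda>p. k < p) U"
proof -
  have "eventually (\<lambda>p. p \<noteq> i) U" for i
    using assms unfolding free_ultrafilter_def by blast
  then have "eventually (\<lambda>p. \<forall>i\<in>{..k}. p \<noteq> i) U"
    by (intro eventually_ball_finite) auto
  then show ?thesis
    by (rule eventually_mono) (auto simp: not_le[symmetric])
qed

text \<open>
  These are the unit functionals of the ultrapower, pulled back to bounded sequences. The bound
  by the eventual size of the coordinates contains both the norm estimate and the vanishing on null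
  sequences, and it turns estimates on \<open>\<psi> z\<close> into estimates on many coordinates of \<open>z\<close>.
\<close>
definition asymptotic_functionals ::
  "nat filter \<Rightarrow> ((nat \<Rightarrow>\<^sub>C 'a::real_normed_vector) \<Rightarrow> real) set" where
  "asymptotic_functionals U = {\<psi>. linear \<psi> \<and>
     (\<forall>z c. eventually (\<lambda>p. norm (apply_bcontfun z p) \<le> c) U \<longrightarrow> \<bar>\<psi> z\<bar> \<le> c)}"

lemma asymptotic_functionals_le:
  assumes "\<psi> \<in> asymptotic_functionals U" "eventually (\<lambda>p. norm (apply_bcontfun z p) \<le> c) U"
  shows "\<bar>\<psi> z\<bar> \<le> c"
  using assms by (simp add: asymptotic_functionals_def)

lemma asymptotic_functionals_norm:
  assumes "\<psi> \<in> asymptotic_functionals U"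
  shows "\<bar>\<psi> z\<bar> \<le> norm z"
  using assms norm_bounded[of z] unfolding asymptotic_functionals_def
  by (auto intro: always_eventually)

lemma asymptotic_functionals_uminus:
  assumes "\<psi> \<in> asymptotic_functionals U"
  shows "(\<lambda>z. - \<psi> z) \<in> asymptotic_functionals U"
  using assms by (auto simp: asymptotic_functionals_def intro: linear_compose_neg)

lemma asymptotic_functionals_Lim:
  assumes U: "free_ultrafilter U" and \<psi>: "\<And>k. \<psi> k \<in> asymptotic_functionals U"
  shows "(\<lambda>z. Lim U (\<lambda>k. \<psi> k z)) \<in> asymptotic_functionals U"
proof -
  have ne: "U \<noteq> bot"
    using U by (simp add: free_ultrafilter_def)
  have lim: "((\<lambda>k. \<psi> k z) \<longlongrightarrow> Lim U (\<lambda>k. \<psi> k z)) U" for z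
    using asymptotic_functionals_norm[OF \<psi>] by (intro ultrafilter_convergent[OF U])
  have lin: "linear (\<psi> k)" for k
    using \<psi> by (simp add: asymptotic_functionals_def)
  have "linear (\<lambda>z. Lim U (\<lambda>k. \<psi> k z))"
  proof (rule linearI)
    fix x y c
    show "Lim U (\<lambda>k. \<psi> k (x + y)) = Lim U (\<lambda>k. \<psi> k x) + Lim U (\<lambda>k. \<psi> k y)"
      using tendsto_add[OF lim[of x] lim[of y]] by (intro tendsto_Lim[OF ne]) (simp add: linear_add[OF lin])
    show "Lim U (\<lambda>k. \<psi> k (c *\<^sub>R x)) = c *\<^sub>R Lim U (\<lambda>k. \<psi> k x)"
      using tendsto_mult[OF tendsto_const lim[of x]] by (intro tendsto_Lim[OF ne]) (simp add: linear_scale[OF lin])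
  qed
  moreover have "\<bar>Lim U (\<lambda>k. \<psi> k z)\<bar> \<le> c"
    if "eventually (\<lambda>p. norm (apply_bcontfun z p) \<le> c) U" for z c
    using \<psi> that
    by (intro tendsto_upperbound[OF tendsto_rabs[OF lim] _ ne] always_eventually)
       (auto simp: asymptotic_functionals_def)
  ultimately show ?thesis
    by (simp add: asymptotic_functionals_def)
qed

lemma asymptotic_functionals_coordinatewise:
  fixes f :: "nat \<Rightarrow> 'a::real_normed_vector \<Rightarrow> real"
  assumes U: "free_ultrafilter U" and f: "\<And>p. f p \<in> unit_functionals"
  shows "((\<lambda>p. f p (apply_bcontfun z p)) \<longlongrightarrow> Lim U (\<lambda>p. f p (apply_bcontfun z p))) U"
    and "(\<lambda>z. Lim U (\<lambda>p. f p (apply_bcontfun z p))) \<in> asymptotic_functionals U"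
proof -
  have ne: "U \<noteq> bot"
    using U by (simp add: free_ultrafilter_def)
  have lim: "((\<lambda>p. f p (apply_bcontfun z p)) \<longlongrightarrow> Lim U (\<lambda>p. f p (apply_bcontfun z p))) U" for z
    by (intro ultrafilter_convergent[OF U, where M = "norm z"] unit_functionals_bound[OF f] norm_bounded)
  then show "((\<lambda>p. f p (apply_bcontfun z p)) \<longlongrightarrow> Lim U (\<lambda>p. f p (apply_bcontfun z p))) U" .
  have lin: "linear (f p)" for p
    using f by (simp add: unit_functionals_def)
  have "linear (\<lambda>z. Lim U (\<lambda>p. f p (apply_bcontfun z p)))"
  proof (rule linearI)
    fix x y :: "nat \<Rightarrow>\<^sub>C 'a" and c
    show "Lim U (\<lambda>p. f p (apply_bcontfun (x + y) p)) =
        Lim U (\<lambda>p. f p (apply_bcontfun x p)) + Lim U (\<lambda>p. f p (apply_bcontfun y p))"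
      using tendsto_add[OF lim[of x] lim[of y]]
      by (intro tendsto_Lim[OF ne]) (simp add: linear_add[OF lin])
    show "Lim U (\<lambda>p. f p (apply_bcontfun (c *\<^sub>R x) p)) = c *\<^sub>R Lim U (\<lambda>p. f p (apply_bcontfun x p))"
      using tendsto_mult[OF tendsto_const lim[of x]]
      by (intro tendsto_Lim[OF ne]) (simp add: linear_scale[OF lin])
  qed
  moreover have "\<bar>Lim U (\<lambda>p. f p (apply_bcontfun z p))\<bar> \<le> c"
    if "eventually (\<lambda>p. norm (apply_bcontfun z p) \<le> c) U" for z c
    by (rule tendsto_upperbound[OF tendsto_rabs[OF lim] _ ne])
       (use that in eventually_elim, rule unit_functionals_bound[OF f])
  ultimately show "(\<lambda>z. Lim U (\<lambda>p. f p (apply_bcontfun z p))) \<in> asymptotic_functionals U"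
    by (simp add: asymptotic_functionals_def)
qed

lemma asymptotic_functionals_null:
  assumes "\<psi> \<in> asymptotic_functionals U" "x - y \<in> null_sequences U"
  shows "\<psi> x = \<psi> y"
proof -
  have "\<bar>\<psi> (x - y)\<bar> \<le> 0 + c" if "c > 0" for c
  proof -
    have "eventually (\<lambda>p. norm (apply_bcontfun (x - y) p) < c) U"
      using assms(2) that unfolding null_sequences_def by (auto intro: order_tendstoD)
    then have "eventually (\<lambda>p. norm (apply_bcontfun (x - y) p) \<le> c) U"
      by (rule eventually_mono) simp
    then show ?thesis
      using assms(1) unfolding asymptotic_functionals_def by simp
  qed
  then have "\<bar>\<psi> (x - y)\<bar> \<le> 0"
    by (rule field_le_epsilon)
  then show ?thesis
    using assms(1) linear_diff[of \<psi> x y] by (simp add: asymptotic_functionals_def)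
qed

lemma coset_eq_iff:
  assumes "subspace N"
  shows "coset N x = coset N y \<longleftrightarrow> x - y \<in> N"
proof
  assume "coset N x = coset N y"
  moreover have "x \<in> coset N x"
    using subspace_0[OF assms] by (force simp: coset_def)
  ultimately show "x - y \<in> N"
    by (auto simp: coset_def)
next
  assume xy: "x - y \<in> N"
  have sub: "coset N a \<subseteq> coset N b" if "a - b \<in> N" for a b
  proof
    fix s assume "s \<in> coset N a"
    then obtain n where "s = a + n" "n \<in> N"
      by (auto simp: coset_def)
    then have "s = b + ((a - b) + n)" "(a - b) + n \<in> N"
      using that subspace_add[OF assms] by auto
    then show "s \<in> coset N b"
      unfolding coset_def by blast
  qed
  have "y - x \<in> N"
    using subspace_neg[OF assms xy] by simp
  then show "coset N x = coset N y"
    using sub xy by blast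
qed

abbreviation ultraclass :: "nat filter \<Rightarrow> (nat \<Rightarrow>\<^sub>C 'a::real_normed_vector) \<Rightarrow> (nat \<Rightarrow>\<^sub>C 'a) set" where
  "ultraclass U \<equiv> coset (null_sequences U)"

lemma ultraclass_eq_iff: "ultraclass U x = ultraclass U y \<longleftrightarrow> x - y \<in> null_sequences U"
  by (rule coset_eq_iff[OF subspace_null_sequences])

lemma vcarrier_ultrapower: "vcarrier (ultrapower U) = range (ultraclass U)"
  by (simp add: ultrapower_def quotient_space_def)

lemma vadd_ultrapower: "vadd (ultrapower U) (ultraclass U x) (ultraclass U y) = ultraclass U (x + y)"
  by (simp add: ultrapower_def coset_add[OF subspace_null_sequences])

lemma vscale_ultrapower: "vscale (ultrapower U) c (ultraclass U x) = ultraclass U (c *\<^sub>R x)"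
  by (simp add: ultrapower_def coset_scale[OF subspace_null_sequences])

lemma ultraclass_member: "x \<in> ultraclass U x"
  using subspace_0[OF subspace_null_sequences] by (force simp: coset_def)

lemma ultraclass_rep: "s \<in> ultraclass U x \<Longrightarrow> ultraclass U s = ultraclass U x"
  unfolding ultraclass_eq_iff by (auto simp: coset_def)

lemma vnorm_ultrapower_le: "vnorm (ultrapower U) (ultraclass U x) \<le> norm x"
proof -
  have "bdd_below (norm ` ultraclass U x)"
    by (rule bdd_belowI2[of _ 0]) simp
  then show ?thesis
    using cINF_lower[OF _ ultraclass_member] by (simp add: ultrapower_def quotient_space_def)
qed

lemma vnorm_ultrapower_ge:
  "(\<And>s. s \<in> ultraclass U x \<Longrightarrow> c \<le> norm s) \<Longrightarrow> c \<le> vnorm (ultrapower U) (ultraclass U x)"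
  using ultraclass_member[of x U] by (auto simp: ultrapower_def quotient_space_def intro!: cINF_greatest)

text \<open>
  Coordinates outside a set of the ultrafilter may be replaced by 0 without changing the class.
\<close>
lemma vnorm_ultrapower_eventually_le:
  fixes z :: "nat \<Rightarrow>\<^sub>C 'a::real_normed_vector"
  assumes "U \<noteq> bot" and ev: "eventually (\<lambda>p. norm (apply_bcontfun z p) \<le> c) U"
  shows "vnorm (ultrapower U) (ultraclass U z) \<le> c"
proof -
  have "\<exists>p. norm (apply_bcontfun z p) \<le> c"
    using assms(1) ev by (rule eventually_happens')
  then have "c \<ge> 0"
    using norm_ge_zero order_trans by blast
  define f where "f p = (if norm (apply_bcontfun z p) \<le> c then apply_bcontfun z p else 0)" for p
  have "f \<in> bcontfun"
    using \<open>c \<ge> 0\<close> by (intro bcontfun_normI[of _ c]) (auto simp: f_def)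
  then have f: "apply_bcontfun (Bcontfun f) = f"
    by (rule Bcontfun_inverse)
  have "eventually (\<lambda>p. norm (apply_bcontfun (Bcontfun f - z) p) = 0) U"
    using ev by (rule eventually_mono) (simp add: f f_def)
  then have "Bcontfun f - z \<in> null_sequences U"
    unfolding null_sequences_def by (simp add: tendsto_eventually)
  then have "ultraclass U z = ultraclass U (Bcontfun f)"
    unfolding ultraclass_eq_iff[symmetric] by simp
  moreover have "norm (Bcontfun f) \<le> c"
    using \<open>c \<ge> 0\<close> by (intro norm_bound) (simp add: f f_def)
  ultimately show ?thesis
    using vnorm_ultrapower_le[of U "Bcontfun f"] by simp
qed

text \<open>
  The supremum defining the dual norm is real-valued, so the bound requires that it ranges over a
  bounded set; this is where the nonnegativity of the norm enters.
\<close>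
lemma functional_le_vnorm:
  assumes "\<And>y. y \<in> vcarrier Y \<Longrightarrow> 0 \<le> vnorm Y y" "g \<in> vcarrier (dual Y)" "y \<in> unit_ball Y"
  shows "\<bar>g y\<bar> \<le> vnorm (dual Y) g"
proof -
  obtain C where C: "\<forall>y\<in>vcarrier Y. \<bar>g y\<bar> \<le> C * vnorm Y y"
    using assms(2) by (auto simp: dual_def functionals_def)
  have "\<bar>g y\<bar> \<le> \<bar>C\<bar>" if "y \<in> unit_ball Y" for y
  proof -
    have y: "y \<in> vcarrier Y" "vnorm Y y \<le> 1"
      using that by (auto simp: unit_ball_def)
    have "\<bar>g y\<bar> \<le> C * vnorm Y y"
      using C y by blast
    also have "\<dots> \<le> \<bar>C\<bar> * 1"
      using assms(1) y by (intro mult_mono) auto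
    finally show ?thesis by simp
  qed
  then have "bdd_above ((\<lambda>y. \<bar>g y\<bar>) ` unit_ball Y)"
    by (intro bdd_aboveI2)
  then show ?thesis
    using cSUP_upper[OF assms(3)] by (simp add: dual_def)
qed

lemma vnorm_ultrapower_nonneg:
  "S \<in> vcarrier (ultrapower U) \<Longrightarrow> 0 \<le> vnorm (ultrapower U) S"
  by (auto simp: vcarrier_ultrapower intro!: vnorm_ultrapower_ge)

lemma ultraclass_unit_ball: "norm z \<le> 1 \<Longrightarrow> ultraclass U z \<in> unit_ball (ultrapower U)"
  using vnorm_ultrapower_le[of U z] by (simp add: unit_ball_def vcarrier_ultrapower)

lemma dual_ultrapower_le_vnorm:
  assumes "g \<in> vcarrier (dual (ultrapower U))" "S \<in> unit_ball (ultrapower U)"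
  shows "\<bar>g S\<bar> \<le> vnorm (dual (ultrapower U)) g"
  by (rule functional_le_vnorm[OF _ assms]) (rule vnorm_ultrapower_nonneg)

lemma vnorm_dual_ultrapower_nonneg:
  assumes "g \<in> vcarrier (dual (ultrapower U))"
  shows "0 \<le> vnorm (dual (ultrapower U)) g"
  using dual_ultrapower_le_vnorm[OF assms ultraclass_unit_ball[of 0]]
  by (metis abs_ge_zero norm_zero order_trans zero_le_one)

lemma dual_ultrapower_linear:
  fixes U :: "nat filter" and g :: "(nat \<Rightarrow>\<^sub>C 'a::real_normed_vector) set \<Rightarrow> real"
  assumes "g \<in> vcarrier (dual (ultrapower U))"
  shows "linear (\<lambda>z. g (ultraclass U z))"
proof (rule linearI)
  fix x y :: "nat \<Rightarrow>\<^sub>C 'a" and c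
  have *: "\<forall>x\<in>range (ultraclass U). \<forall>y\<in>range (ultraclass U). g (vadd (ultrapower U) x y) = g x + g y"
    "\<forall>c. \<forall>x\<in>range (ultraclass U). g (vscale (ultrapower U) c x) = c * g x"
    using assms by (simp_all add: dual_def functionals_def vcarrier_ultrapower)
  show "g (ultraclass U (x + y)) = g (ultraclass U x) + g (ultraclass U y)"
    using *(1) by (simp flip: vadd_ultrapower)
  show "g (ultraclass U (c *\<^sub>R x)) = c *\<^sub>R g (ultraclass U x)"
    using *(2) by (simp flip: vscale_ultrapower)
qed

lemma dual_ultrapower_bound:
  assumes g: "g \<in> vcarrier (dual (ultrapower U))" and "U \<noteq> bot" "R > 0"
    and ev: "eventually (\<lambda>p. norm (apply_bcontfun z p) \<le> R) U"
  shows "\<bar>g (ultraclass U z)\<bar> \<le> R * vnorm (dual (ultrapower U)) g"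
proof -
  have "eventually (\<lambda>p. norm (apply_bcontfun ((1 / R) *\<^sub>R z) p) \<le> 1) U"
    using ev by (rule eventually_mono) (use \<open>R > 0\<close> in simp)
  then have "vnorm (ultrapower U) (ultraclass U ((1 / R) *\<^sub>R z)) \<le> 1"
    by (rule vnorm_ultrapower_eventually_le[OF assms(2)])
  then have "ultraclass U ((1 / R) *\<^sub>R z) \<in> unit_ball (ultrapower U)"
    by (simp add: unit_ball_def vcarrier_ultrapower)
  then have "\<bar>g (ultraclass U ((1 / R) *\<^sub>R z))\<bar> \<le> vnorm (dual (ultrapower U)) g"
    by (rule dual_ultrapower_le_vnorm[OF g])
  moreover have "g (ultraclass U ((1 / R) *\<^sub>R z)) = g (ultraclass U z) / R"
    using linear_scale[OF dual_ultrapower_linear[OF g], of "1 / R" z] by simp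
  ultimately show ?thesis
    using \<open>R > 0\<close> by (simp add: abs_divide field_simps)
qed

text \<open>
  This lemma and the next identify \<open>asymptotic_functionals U\<close> with the unit ball of the dual of the
  ultrapower.
\<close>
lemma dual_unit_ball_asymptotic:
  assumes U: "U \<noteq> bot" and g: "g \<in> unit_ball (dual (ultrapower U))"
  shows "(\<lambda>z. g (ultraclass U z)) \<in> asymptotic_functionals U"
proof -
  have g': "g \<in> vcarrier (dual (ultrapower U))" "vnorm (dual (ultrapower U)) g \<le> 1"
    using g by (auto simp: unit_ball_def)
  have "\<bar>g (ultraclass U z)\<bar> \<le> c" if ev: "eventually (\<lambda>p. norm (apply_bcontfun z p) \<le> c) U" for z c
  proof (rule field_le_epsilon)
    fix d :: real assume "d > 0"
    have "0 \<le> c"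
      using eventually_happens'[OF U ev] norm_ge_zero order_trans by blast
    then have "c + d > 0"
      using \<open>d > 0\<close> by simp
    moreover have "eventually (\<lambda>p. norm (apply_bcontfun z p) \<le> c + d) U"
      using ev by (rule eventually_mono) (use \<open>d > 0\<close> in simp)
    ultimately have "\<bar>g (ultraclass U z)\<bar> \<le> (c + d) * vnorm (dual (ultrapower U)) g"
      by (intro dual_ultrapower_bound[OF g'(1) U])
    also have "\<dots> \<le> (c + d) * 1"
      using g'(2) \<open>c + d > 0\<close> by (intro mult_left_mono) auto
    finally show "\<bar>g (ultraclass U z)\<bar> \<le> c + d"
      by simp
  qed
  then show ?thesis
    using dual_ultrapower_linear[OF g'(1)] by (simp add: asymptotic_functionals_def)
qed

lemma asymptotic_functional_dual:
  fixes \<psi> :: "(nat \<Rightarrow>\<^sub>C 'a::real_normed_vector) \<Rightarrow> real"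
  assumes \<psi>: "\<psi> \<in> asymptotic_functionals U"
  obtains g where "g \<in> unit_ball (dual (ultrapower U))" "\<And>z. g (ultraclass U z) = \<psi> z"
proof -
  define g where "g = (\<lambda>S\<in>range (ultraclass U). \<psi> (SOME z. ultraclass U z = S))"
  have g: "g (ultraclass U z) = \<psi> z" for z
  proof -
    have "ultraclass U (SOME y. ultraclass U y = ultraclass U z) = ultraclass U z"
      by (rule someI) (rule refl)
    then have "\<psi> (SOME y. ultraclass U y = ultraclass U z) = \<psi> z"
      using asymptotic_functionals_null[OF \<psi>] ultraclass_eq_iff by blast
    then show ?thesis
      by (simp add: g_def)
  qed
  have lin: "linear \<psi>"
    using \<psi> by (simp add: asymptotic_functionals_def)
  have le: "\<bar>g (ultraclass U z)\<bar> \<le> vnorm (ultrapower U) (ultraclass U z)" for z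
  proof (rule vnorm_ultrapower_ge)
    fix s assume "s \<in> ultraclass U z"
    then have "ultraclass U z = ultraclass U s"
      by (rule ultraclass_rep[symmetric])
    then show "\<bar>g (ultraclass U z)\<bar> \<le> norm s"
      using asymptotic_functionals_norm[OF \<psi>, of s] by (simp add: g)
  qed
  have "g \<in> functionals (ultrapower U)"
    unfolding functionals_def vcarrier_ultrapower
    using lin le by (auto simp: vadd_ultrapower vscale_ultrapower g linear_add linear_scale
        intro!: exI[of _ 1]) (auto simp: g_def)
  moreover have "(SUP x\<in>unit_ball (ultrapower U). \<bar>g x\<bar>) \<le> 1"
  proof (rule cSUP_least)
    show "unit_ball (ultrapower U :: (nat \<Rightarrow>\<^sub>C 'a) set nspace) \<noteq> {}"
      using ultraclass_unit_ball[of 0 U] by force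
    show "\<bar>g x\<bar> \<le> 1" if "x \<in> unit_ball (ultrapower U)" for x
      using that le order_trans by (auto simp: unit_ball_def vcarrier_ultrapower)
  qed
  ultimately have "g \<in> unit_ball (dual (ultrapower U))"
    by (simp add: unit_ball_def dual_def)
  then show thesis
    using g that by blast
qed

section \<open>Separated systems violate weak compactness\<close>

definition weakly_compact_up_to :: "'v nspace \<Rightarrow> 'v set \<Rightarrow> real \<Rightarrow> bool" where
  "weakly_compact_up_to Y B \<epsilon> \<longleftrightarrow>
     weak_star (dual Y) closure_of (canonical_embedding Y ` B) \<subseteq>
       {vadd (bidual Y) (canonical_embedding Y y) (vscale (bidual Y) \<epsilon> \<psi>) | y \<psi>.
          y \<in> vcarrier Y \<and> \<psi> \<in> unit_ball (bidual Y)}"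

lemma gamma_wc_alt: "gamma_wc Y B = Inf {\<epsilon>. \<epsilon> > 0 \<and> weakly_compact_up_to Y B \<epsilon>}"
  by (simp add: gamma_wc_def weakly_compact_up_to_def)

lemma vcarrier_dual: "vcarrier (dual Y) = functionals Y"
  by (simp add: dual_def)

lemma bidual_translate:
  assumes "f \<in> vcarrier (dual Y)"
  shows "vadd (bidual Y) (canonical_embedding Y y) (vscale (bidual Y) \<epsilon> \<psi>) f = f y + \<epsilon> * \<psi> f"
proof -
  have "vadd (bidual Y) h k f = h f + k f" "vscale (bidual Y) \<epsilon> h f = \<epsilon> * h f" for h k
    using assms by (simp_all add: dual_def[of "dual Y"])
  then show ?thesis
    using assms by (simp add: canonical_embedding_def)
qed

lemma vadd_dual_ultrapower:
  "vadd (dual (ultrapower U)) f g (ultraclass U z) = f (ultraclass U z) + g (ultraclass U z)"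
  by (simp add: dual_def vcarrier_ultrapower)

lemma vscale_dual_ultrapower:
  "vscale (dual (ultrapower U)) c f (ultraclass U z) = c * f (ultraclass U z)"
  by (simp add: dual_def vcarrier_ultrapower)

lemma dual_ultrapower_iff:
  "g \<in> vcarrier (dual (ultrapower U)) \<longleftrightarrow> g \<in> extensional (range (ultraclass U)) \<and>
     linear (\<lambda>z. g (ultraclass U z)) \<and>
     (\<exists>C. \<forall>z. \<bar>g (ultraclass U z)\<bar> \<le> C * vnorm (ultrapower U) (ultraclass U z))"
  by (auto simp: vcarrier_dual functionals_def vcarrier_ultrapower vadd_ultrapower vscale_ultrapower
      linear_iff)

lemma dual_ultrapower_add:
  assumes "f \<in> vcarrier (dual (ultrapower U))" "g \<in> vcarrier (dual (ultrapower U))"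
  shows "vadd (dual (ultrapower U)) f g \<in> vcarrier (dual (ultrapower U))"
proof -
  obtain C D where C: "\<And>z. \<bar>f (ultraclass U z)\<bar> \<le> C * vnorm (ultrapower U) (ultraclass U z)"
    and D: "\<And>z. \<bar>g (ultraclass U z)\<bar> \<le> D * vnorm (ultrapower U) (ultraclass U z)"
    using assms unfolding dual_ultrapower_iff by blast
  have "\<bar>f (ultraclass U z) + g (ultraclass U z)\<bar> \<le> (C + D) * vnorm (ultrapower U) (ultraclass U z)" for z
    using C[of z] D[of z] by (simp add: distrib_right)
  moreover have "vadd (dual (ultrapower U)) f g \<in> extensional (range (ultraclass U))"
    by (simp add: dual_def vcarrier_ultrapower)
  ultimately show ?thesis
    using assms unfolding dual_ultrapower_iff vadd_dual_ultrapower by (auto intro: linear_compose_add)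
qed

lemma dual_ultrapower_scale:
  assumes "f \<in> vcarrier (dual (ultrapower U))"
  shows "vscale (dual (ultrapower U)) c f \<in> vcarrier (dual (ultrapower U))"
proof -
  obtain C where C: "\<And>z. \<bar>f (ultraclass U z)\<bar> \<le> C * vnorm (ultrapower U) (ultraclass U z)"
    using assms unfolding dual_ultrapower_iff by blast
  have "\<bar>c * f (ultraclass U z)\<bar> \<le> (\<bar>c\<bar> * C) * vnorm (ultrapower U) (ultraclass U z)" for z
    using mult_left_mono[OF C[of z], of "\<bar>c\<bar>"] by (simp add: abs_mult mult.assoc)
  moreover have "vscale (dual (ultrapower U)) c f \<in> extensional (range (ultraclass U))"
    by (simp add: dual_def vcarrier_ultrapower)
  moreover have "linear (\<lambda>z. c * f (ultraclass U z))"
    using assms linear_compose_scale_right[of "\<lambda>z. f (ultraclass U z)" c]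
    unfolding dual_ultrapower_iff by simp
  ultimately show ?thesis
    unfolding dual_ultrapower_iff vscale_dual_ultrapower by blast
qed

lemma bidual_ultrapower_le:
  assumes h: "h \<in> unit_ball (bidual (ultrapower U))" and f: "f \<in> unit_ball (dual (ultrapower U))"
  shows "\<bar>h f\<bar> \<le> 1"
proof -
  have "\<bar>h f\<bar> \<le> vnorm (bidual (ultrapower U)) h"
    using h by (intro functional_le_vnorm[OF _ _ f] vnorm_dual_ultrapower_nonneg) (simp_all add: unit_ball_def)
  then show ?thesis
    using h by (simp add: unit_ball_def)
qed

text \<open>
  A bounded sequence of classes converges along \<open>U\<close> in the weak-star topology of the bidual, with the
  pointwise limit as its limit.
\<close>
lemma Lim_in_bidual:
  fixes x :: "nat \<Rightarrow> (nat \<Rightarrow>\<^sub>C 'a::real_normed_vector)"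
  assumes U: "free_ultrafilter U" and R: "R > 0" "\<And>i. norm (x i) \<le> R"
  shows "(\<lambda>f\<in>vcarrier (dual (ultrapower U)). Lim U (\<lambda>i. f (ultraclass U (x i))))
      \<in> vcarrier (bidual (ultrapower U))" (is "?h \<in> _")
    and "f \<in> vcarrier (dual (ultrapower U)) \<Longrightarrow>
      ((\<lambda>i. f (ultraclass U (x i))) \<longlongrightarrow> Lim U (\<lambda>i. f (ultraclass U (x i)))) U"
proof -
  let ?D = "vcarrier (dual (ultrapower U)) :: ((nat \<Rightarrow>\<^sub>C 'a) set \<Rightarrow> real) set"
  have ne: "U \<noteq> bot"
    using U by (simp add: free_ultrafilter_def)
  have le: "\<bar>f (ultraclass U (x i))\<bar> \<le> R * vnorm (dual (ultrapower U)) f" if "f \<in> ?D" for f i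
    using norm_bounded[of "x i"] R(2)[of i] order_trans
    by (intro dual_ultrapower_bound[OF that ne R(1)] always_eventually) blast
  have lim: "((\<lambda>i. f (ultraclass U (x i))) \<longlongrightarrow> Lim U (\<lambda>i. f (ultraclass U (x i)))) U"
    if "f \<in> ?D" for f
    by (rule ultrafilter_convergent[OF U le[OF that]])
  then show "f \<in> ?D \<Longrightarrow>
      ((\<lambda>i. f (ultraclass U (x i))) \<longlongrightarrow> Lim U (\<lambda>i. f (ultraclass U (x i)))) U" .
  have "?h (vadd (dual (ultrapower U)) f g) = ?h f + ?h g" if "f \<in> ?D" "g \<in> ?D" for f g
    using that dual_ultrapower_add[OF that] tendsto_add[OF lim[OF that(1)] lim[OF that(2)]]
    by (simp add: vadd_dual_ultrapower tendsto_Lim[OF ne])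
  moreover have "?h (vscale (dual (ultrapower U)) c f) = c * ?h f" if "f \<in> ?D" for f c
    using that dual_ultrapower_scale[OF that] tendsto_mult[OF tendsto_const lim[OF that], of c]
    by (simp add: vscale_dual_ultrapower tendsto_Lim[OF ne])
  moreover have "\<bar>?h f\<bar> \<le> R * vnorm (dual (ultrapower U)) f" if "f \<in> ?D" for f
    using that le[OF that] tendsto_upperbound[OF tendsto_rabs[OF lim[OF that]] _ ne]
    by (simp add: always_eventually)
  moreover have "?h \<in> extensional ?D"
    by (rule restrict_extensional)
  ultimately show "?h \<in> vcarrier (bidual (ultrapower U))"
    unfolding vcarrier_dual[of "dual (ultrapower U)"] functionals_def mem_Collect_eq by blast
qed

text \<open>
  The systems of length \<open>p\<close> give, coordinate by coordinate, classes \<open>y\<^sub>i\<close> and functionals \<open>\<psi>\<^sub>k\<close> with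
  \<open>\<psi>\<^sub>k(y\<^sub>l) - \<psi>\<^sub>k(y\<^sub>i) \<ge> \<epsilon>\<close> for all \<open>i < k \<le> l\<close>. Let \<open>h\<close> be the weak-star limit of the \<open>y\<^sub>i\<close>, let \<open>\<omega>\<close> be the
  limit of the \<open>\<psi>\<^sub>k\<close>, and let \<open>z\<close> be a vector within \<open>\<delta>\<close> of \<open>h\<close>. Letting \<open>l\<close> tend to the limit gives
  \<open>\<psi>\<^sub>k(z) \<ge> \<psi>\<^sub>k(y\<^sub>i) + \<epsilon> - \<delta>\<close>; letting \<open>k\<close> and then \<open>i\<close> do so gives \<open>\<omega>(z) \<ge> h(\<omega>) + \<epsilon> - \<delta>\<close>, whereas
  \<open>h(\<omega>) \<ge> \<omega>(z) - \<delta>\<close>.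
\<close>
lemma separated_system_not_weakly_compact:
  fixes A :: "'a::real_normed_vector set"
  assumes U: "free_ultrafilter U" and "bounded A" and sep: "\<And>n. separated_system A \<epsilon> n"
    and wc: "weakly_compact_up_to (ultrapower U) (set_ultrapower U A) \<delta>" and "\<delta> > 0"
  shows "\<epsilon> \<le> 2 * \<delta>"
proof -
  have ne: "U \<noteq> bot"
    using U by (simp add: free_ultrafilter_def)
  obtain R where R: "R > 0" "\<And>a. a \<in> A \<Longrightarrow> norm a \<le> R"
    using assms(2) unfolding bounded_pos by blast
  obtain a0 where a0: "a0 \<in> A"
    using sep[of 1] unfolding separated_system_def by auto
  have "\<forall>p::nat. \<exists>x f. (\<forall>i<p. x i \<in> A \<and> f i \<in> unit_functionals) \<and>
     (\<forall>i k l. i < k \<longrightarrow> k \<le> l \<longrightarrow> l < p \<longrightarrow> \<epsilon> \<le> f k (x l) - f k (x i))"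
    by (intro allI) (rule sep[unfolded separated_system_def])
  from choice[OF this] obtain X where "\<forall>p::nat. \<exists>f. (\<forall>i<p. X p i \<in> A \<and> f i \<in> unit_functionals) \<and>
     (\<forall>i k l. i < k \<longrightarrow> k \<le> l \<longrightarrow> l < p \<longrightarrow> \<epsilon> \<le> f k (X p l) - f k (X p i))" ..
  from choice[OF this] obtain F where "\<forall>p::nat. (\<forall>i<p. X p i \<in> A \<and> F p i \<in> unit_functionals) \<and>
     (\<forall>i k l. i < k \<longrightarrow> k \<le> l \<longrightarrow> l < p \<longrightarrow> \<epsilon> \<le> F p k (X p l) - F p k (X p i))" ..
  then have X: "\<And>p i. i < p \<Longrightarrow> X p i \<in> A"
    and F: "\<And>p i. i < p \<Longrightarrow> F p i \<in> unit_functionals"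
    and XF: "\<And>p i k l. i < k \<Longrightarrow> k \<le> l \<Longrightarrow> l < p \<Longrightarrow> \<epsilon> \<le> F p k (X p l) - F p k (X p i)"
    by auto
  \<comment> \<open>Values for the finitely many \<open>p \<le> i\<close> do not affect limits along \<open>U\<close>; the defaults keep the sequence
    in \<open>A\<close> and the functionals in the unit ball.\<close>
  define Y where "Y i p = (if i < p then X p i else a0)" for i p
  have Y: "Y i p \<in> A" for i p
    by (simp add: Y_def X a0)
  define y where "y i = Bcontfun (Y i)" for i
  have "Y i \<in> bcontfun" for i
    using R(2)[OF Y] by (intro bcontfun_normI[of _ R]) auto
  then have y: "apply_bcontfun (y i) = Y i" for i
    by (simp add: y_def Bcontfun_inverse)
  have yR: "norm (y i) \<le> R" for i
    using R(2)[OF Y] by (intro norm_bound) (simp add: y)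
  define G where "G k p = (if k < p then F p k else (\<lambda>_. 0))" for k p
  have G: "G k p \<in> unit_functionals" for k p
    using F by (simp add: G_def unit_functionals_def linear_zero)
  define \<psi> where "\<psi> k z = Lim U (\<lambda>p. G k p (apply_bcontfun z p))" for k z
  have \<psi>: "\<psi> k \<in> asymptotic_functionals U" for k
    unfolding \<psi>_def by (rule asymptotic_functionals_coordinatewise[OF U G])
  have gap: "\<epsilon> \<le> \<psi> k (y l) - \<psi> k (y i)" if "i < k" "k \<le> l" for i k l
  proof (rule tendsto_lowerbound[OF _ _ ne])
    show "((\<lambda>p. G k p (apply_bcontfun (y l) p) - G k p (apply_bcontfun (y i) p))
        \<longlongrightarrow> \<psi> k (y l) - \<psi> k (y i)) U"
      unfolding \<psi>_def by (intro tendsto_diff asymptotic_functionals_coordinatewise(1)[OF U G])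
    show "eventually (\<lambda>p. \<epsilon> \<le> G k p (apply_bcontfun (y l) p) - G k p (apply_bcontfun (y i) p)) U"
      using free_ultrafilter_gt[OF U, of l]
      by (rule eventually_mono) (use that XF in \<open>simp add: G_def Y_def y\<close>)
  qed
  define \<omega> where "\<omega> z = Lim U (\<lambda>k. \<psi> k z)" for z
  have \<omega>: "\<omega> \<in> asymptotic_functionals U"
    unfolding \<omega>_def by (rule asymptotic_functionals_Lim[OF U \<psi>])
  have lim_\<omega>: "((\<lambda>k. \<psi> k z) \<longlongrightarrow> \<omega> z) U" for z
    unfolding \<omega>_def by (rule ultrafilter_convergent[OF U asymptotic_functionals_norm[OF \<psi>]])
  define h where "h = (\<lambda>f\<in>vcarrier (dual (ultrapower U)). Lim U (\<lambda>i. f (ultraclass U (y i))))"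
  have h: "h \<in> vcarrier (bidual (ultrapower U))"
    unfolding h_def by (rule Lim_in_bidual[OF U R(1) yR])
  have lim_h: "((\<lambda>i. f (ultraclass U (y i))) \<longlongrightarrow> h f) U" if "f \<in> vcarrier (dual (ultrapower U))" for f
    using that Lim_in_bidual(2)[OF U R(1) yR that] by (simp add: h_def)
  have emb: "canonical_embedding (ultrapower U) (ultraclass U (y i)) \<in> vcarrier (bidual (ultrapower U))" for i
  proof -
    have "Lim U (\<lambda>_. c) = c" for c :: real
      by (rule tendsto_Lim[OF ne tendsto_const])
    then show ?thesis
      using Lim_in_bidual(1)[OF U R(1), of "\<lambda>_. y i"] yR by (simp add: canonical_embedding_def)
  qed
  let ?W = "weak_star (dual (ultrapower U)) :: (((nat \<Rightarrow>\<^sub>C 'a) set \<Rightarrow> real) \<Rightarrow> real) topology"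
  have "limitin ?W (\<lambda>i. canonical_embedding (ultrapower U) (ultraclass U (y i))) h U"
    unfolding weak_star_def limitin_subtopology limitin_componentwise
  proof (intro conjI)
    show "h \<in> extensional (vcarrier (dual (ultrapower U)))"
      by (simp add: h_def)
    show "\<forall>f\<in>vcarrier (dual (ultrapower U)).
        limitin euclideanreal (\<lambda>i. canonical_embedding (ultrapower U) (ultraclass U (y i)) f) (h f) U"
      using lim_h by (simp add: canonical_embedding_def)
  qed (use h emb in \<open>auto simp: canonical_embedding_def\<close>)
  then have "h \<in> ?W closure_of (canonical_embedding (ultrapower U) ` set_ultrapower U A)"
    unfolding in_closure_of limitin_def
  proof (intro conjI allI impI; elim conjE)
    fix T assume T: "h \<in> T" "openin ?W T"
      and "\<forall>T. openin ?W T \<and> h \<in> T \<longrightarrow>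
        (\<forall>\<^sub>F i in U. canonical_embedding (ultrapower U) (ultraclass U (y i)) \<in> T)"
    then have "\<forall>\<^sub>F i in U. canonical_embedding (ultrapower U) (ultraclass U (y i)) \<in> T"
      by blast
    then obtain i where "canonical_embedding (ultrapower U) (ultraclass U (y i)) \<in> T"
      using eventually_happens'[OF ne] by blast
    moreover have "ultraclass U (y i) \<in> set_ultrapower U A"
      unfolding set_ultrapower_def by (rule imageI) (simp add: y Y)
    ultimately show "\<exists>g. g \<in> canonical_embedding (ultrapower U) ` set_ultrapower U A \<and> g \<in> T"
      by blast
  qed
  then obtain S k where S: "S \<in> vcarrier (ultrapower U)" and k: "k \<in> unit_ball (bidual (ultrapower U))"
    and hk: "h = vadd (bidual (ultrapower U)) (canonical_embedding (ultrapower U) S)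
      (vscale (bidual (ultrapower U)) \<delta> k)"
    using wc unfolding weakly_compact_up_to_def by blast
  obtain z where z: "S = ultraclass U z"
    using S by (auto simp: vcarrier_ultrapower)
  have near: "\<bar>h f - f (ultraclass U z)\<bar> \<le> \<delta>" if f: "f \<in> unit_ball (dual (ultrapower U))" for f
  proof -
    have "h f = f (ultraclass U z) + \<delta> * k f"
      unfolding hk z using f by (intro bidual_translate) (simp add: unit_ball_def)
    then show ?thesis
      using bidual_ultrapower_le[OF k f] \<open>\<delta> > 0\<close> by (simp add: abs_mult)
  qed
  have step: "\<psi> k (y i) + \<epsilon> - \<delta> \<le> \<psi> k z" if "i < k" for i k
  proof -
    obtain f where f: "f \<in> unit_ball (dual (ultrapower U))" "\<And>z. f (ultraclass U z) = \<psi> k z"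
      using asymptotic_functional_dual[OF \<psi>] by blast
    have "\<psi> k (y i) + \<epsilon> \<le> h f"
    proof (rule tendsto_lowerbound[OF _ _ ne])
      show "((\<lambda>l. \<psi> k (y l)) \<longlongrightarrow> h f) U"
        using lim_h[of f] f by (simp add: unit_ball_def)
      show "eventually (\<lambda>l. \<psi> k (y i) + \<epsilon> \<le> \<psi> k (y l)) U"
        using free_ultrafilter_gt[OF U, of k]
      proof (rule eventually_mono)
        fix l assume "k < l"
        then show "\<psi> k (y i) + \<epsilon> \<le> \<psi> k (y l)"
          using gap[OF that, of l] by simp
      qed
    qed
    then show ?thesis
      using near[OF f(1)] f(2) by simp
  qed
  have "\<omega> (y i) + \<epsilon> - \<delta> \<le> \<omega> z" for i
  proof (rule tendsto_le[OF ne lim_\<omega>])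
    show "((\<lambda>k. \<psi> k (y i) + \<epsilon> - \<delta>) \<longlongrightarrow> \<omega> (y i) + \<epsilon> - \<delta>) U"
      by (intro tendsto_intros lim_\<omega>)
    show "eventually (\<lambda>k. \<psi> k (y i) + \<epsilon> - \<delta> \<le> \<psi> k z) U"
      using free_ultrafilter_gt[OF U, of i] step by (rule eventually_mono)
  qed
  moreover obtain f where f: "f \<in> unit_ball (dual (ultrapower U))" "\<And>z. f (ultraclass U z) = \<omega> z"
    using asymptotic_functional_dual[OF \<omega>] by blast
  ultimately have "h f \<le> \<omega> z - \<epsilon> + \<delta>"
    using lim_h[of f] by (intro tendsto_upperbound[OF _ _ ne]) (auto simp: unit_ball_def algebra_simps intro!: always_eventually)
  then show ?thesis
    using near[OF f(1)] f(2)[of z] by simp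
qed

section \<open>Failure of weak compactness yields separated systems\<close>

lemma weak_star_approximation:
  assumes h: "h \<in> weak_star Y closure_of G" and \<Phi>: "finite \<Phi>" "\<Phi> \<subseteq> vcarrier Y" and \<eta>: "\<eta> > 0"
  obtains g where "g \<in> G" "\<And>f. f \<in> \<Phi> \<Longrightarrow> \<bar>g f - h f\<bar> < \<eta>"
proof -
  define X where "X f = (if f \<in> \<Phi> then ball (h f) \<eta> else UNIV)" for f
  have "openin (product_topology (\<lambda>_. euclideanreal) (vcarrier Y)) (\<Pi>\<^sub>E f\<in>vcarrier Y. X f)"
  proof (rule product_topology_basis)
    show "finite {f. X f \<noteq> topspace euclideanreal}"
      by (rule finite_subset[OF _ \<Phi>(1)]) (auto simp: X_def)
  qed (auto simp: X_def)
  then have "openin (weak_star Y) (vcarrier (dual Y) \<inter> (\<Pi>\<^sub>E f\<in>vcarrier Y. X f))"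
    unfolding weak_star_def by (rule openin_subtopology_Int2)
  moreover have "h \<in> vcarrier (dual Y)"
    using h unfolding in_closure_of by (simp add: weak_star_def)
  then have "h \<in> vcarrier (dual Y) \<inter> (\<Pi>\<^sub>E f\<in>vcarrier Y. X f)"
    using \<eta> by (auto simp: X_def vcarrier_dual functionals_def extensional_def PiE_def)
  ultimately obtain g where g: "g \<in> G" "g \<in> (\<Pi>\<^sub>E f\<in>vcarrier Y. X f)"
    using h unfolding in_closure_of by blast
  have "\<bar>g f - h f\<bar> < \<eta>" if "f \<in> \<Phi>" for f
  proof -
    have "g f \<in> X f"
      using g(2) \<Phi>(2) that by auto
    then show ?thesis
      using that by (simp add: X_def dist_real_def abs_minus_commute)
  qed
  then show thesis
    using g(1) that by blast
qed

text \<open>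
  The vector \<open>k\<close> is \<open>(h - z) / \<epsilon>\<close>; the hypothesis says that its norm is at most one.
\<close>
lemma bidual_ultrapower_rescale:
  fixes z :: "nat \<Rightarrow>\<^sub>C 'a::real_normed_vector"
  assumes h: "h \<in> vcarrier (bidual (ultrapower U))" and "U \<noteq> bot" and \<epsilon>: "\<epsilon> > 0"
    and near: "\<And>f. f \<in> unit_ball (dual (ultrapower U)) \<Longrightarrow> \<bar>h f - f (ultraclass U z)\<bar> \<le> \<epsilon>"
  obtains k where "k \<in> unit_ball (bidual (ultrapower U))"
    "h = vadd (bidual (ultrapower U)) (canonical_embedding (ultrapower U) (ultraclass U z))
       (vscale (bidual (ultrapower U)) \<epsilon> k)"
proof
  let ?D = "vcarrier (dual (ultrapower U))"
  let ?k = "\<lambda>f\<in>?D. (h f - f (ultraclass U z)) / \<epsilon>"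
  obtain C where C: "\<And>f. f \<in> ?D \<Longrightarrow> \<bar>h f\<bar> \<le> C * vnorm (dual (ultrapower U)) f"
    and hadd: "\<And>f g. f \<in> ?D \<Longrightarrow> g \<in> ?D \<Longrightarrow> h (vadd (dual (ultrapower U)) f g) = h f + h g"
    and hscale: "\<And>f c. f \<in> ?D \<Longrightarrow> h (vscale (dual (ultrapower U)) c f) = c * h f"
    and hext: "h \<in> extensional ?D"
    using h unfolding vcarrier_dual[of "dual (ultrapower U)"] functionals_def by blast
  define R where "R = norm z + 1"
  have R: "R > 0"
    using norm_ge_zero[of z] unfolding R_def by linarith
  have zle: "\<bar>f (ultraclass U z)\<bar> \<le> R * vnorm (dual (ultrapower U)) f" if "f \<in> ?D" for f
    using norm_bounded[of z] by (intro dual_ultrapower_bound[OF that assms(2) R] always_eventually)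
      (simp add: R_def add_increasing2)
  have "?k (vadd (dual (ultrapower U)) f g) = ?k f + ?k g" if "f \<in> ?D" "g \<in> ?D" for f g
    using that dual_ultrapower_add[OF that]
    by (simp add: hadd vadd_dual_ultrapower diff_divide_distrib add_divide_distrib)
  moreover have "?k (vscale (dual (ultrapower U)) c f) = c * ?k f" if "f \<in> ?D" for f c
    using that dual_ultrapower_scale[OF that, of c]
    by (simp add: hscale vscale_dual_ultrapower right_diff_distrib diff_divide_distrib)
  moreover have "\<bar>?k f\<bar> \<le> ((C + R) / \<epsilon>) * vnorm (dual (ultrapower U)) f" if "f \<in> ?D" for f
  proof -
    have "\<bar>h f - f (ultraclass U z)\<bar> \<le> (C + R) * vnorm (dual (ultrapower U)) f"
      using C[OF that] zle[OF that] by (simp add: distrib_right)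
    then have "\<bar>h f - f (ultraclass U z)\<bar> / \<epsilon> \<le> (C + R) * vnorm (dual (ultrapower U)) f / \<epsilon>"
      using \<epsilon> by (intro divide_right_mono) auto
    then show ?thesis
      using that \<epsilon> by (simp add: abs_divide)
  qed
  moreover have "?k \<in> extensional ?D"
    by (rule restrict_extensional)
  ultimately have k: "?k \<in> vcarrier (bidual (ultrapower U))"
    unfolding vcarrier_dual[of "dual (ultrapower U)"] functionals_def mem_Collect_eq by blast
  have "(SUP f\<in>unit_ball (dual (ultrapower U)). \<bar>?k f\<bar>) \<le> 1"
  proof (rule cSUP_least)
    have "0 \<le> c" if "eventually (\<lambda>p. norm (apply_bcontfun x p) \<le> c) U"
      for x :: "nat \<Rightarrow>\<^sub>C 'a" and c
      using eventually_happens'[OF assms(2) that] norm_ge_zero order_trans by blast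
    then have "(\<lambda>_ :: nat \<Rightarrow>\<^sub>C 'a. 0) \<in> asymptotic_functionals U"
      by (simp add: asymptotic_functionals_def linear_zero)
    then obtain g :: "(nat \<Rightarrow>\<^sub>C 'a) set \<Rightarrow> real" where "g \<in> unit_ball (dual (ultrapower U))"
      using asymptotic_functional_dual by blast
    then show "unit_ball (dual (ultrapower U) :: ((nat \<Rightarrow>\<^sub>C 'a) set \<Rightarrow> real) nspace) \<noteq> {}"
      by (auto simp only: empty_iff)
    show "\<bar>?k f\<bar> \<le> 1" if "f \<in> unit_ball (dual (ultrapower U))" for f
      using near[OF that] that \<epsilon> by (simp add: unit_ball_def abs_divide)
  qed
  then show "?k \<in> unit_ball (bidual (ultrapower U))"
    using k by (simp add: unit_ball_def dual_def[of "dual (ultrapower U)"])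
  show "h = vadd (bidual (ultrapower U)) (canonical_embedding (ultrapower U) (ultraclass U z))
      (vscale (bidual (ultrapower U)) \<epsilon> ?k)"
  proof (rule extensionalityI[of _ ?D])
    show "vadd (bidual (ultrapower U)) (canonical_embedding (ultrapower U) (ultraclass U z))
      (vscale (bidual (ultrapower U)) \<epsilon> ?k) \<in> extensional ?D"
      by (simp add: dual_def[of "dual (ultrapower U)"])
    show "h f = vadd (bidual (ultrapower U)) (canonical_embedding (ultrapower U) (ultraclass U z))
      (vscale (bidual (ultrapower U)) \<epsilon> ?k) f" if "f \<in> ?D" for f
      unfolding bidual_translate[OF that] using that \<epsilon> by simp
  qed (rule hext)
qed

text \<open>
  Let \<open>h\<close> be a limit point that is further than \<open>\<epsilon>\<close> from every \<open>z\<close>. Then \<open>\<psi> z\<close> is, up to its sign, a unit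
  functional that witnesses the distance from \<open>z\<close>, and \<open>t z\<close> is its value at \<open>h\<close>. Elements of \<open>B\<^sup>U\<close> near
  \<open>h\<close> nearly attain finitely many of these values at once.
\<close>
lemma not_weakly_compact_witnesses:
  fixes B :: "'a::real_normed_vector set"
  assumes U: "free_ultrafilter U" and \<epsilon>: "\<epsilon> > 0"
    and nwc: "\<not> weakly_compact_up_to (ultrapower U) (set_ultrapower U B) \<epsilon>"
  obtains \<psi> :: "(nat \<Rightarrow>\<^sub>C 'a) \<Rightarrow> (nat \<Rightarrow>\<^sub>C 'a) \<Rightarrow> real" and t
  where "\<And>z. \<psi> z \<in> asymptotic_functionals U" "\<And>z. \<epsilon> < t z - \<psi> z z"
    "\<And>T \<eta>. finite T \<Longrightarrow> \<eta> > 0 \<Longrightarrow>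
       \<exists>x. (\<forall>p. apply_bcontfun x p \<in> B) \<and> (\<forall>z\<in>T. \<bar>\<psi> z x - t z\<bar> < \<eta>)"
proof -
  have ne: "U \<noteq> bot"
    using U by (simp add: free_ultrafilter_def)
  obtain h where h: "h \<in> weak_star (dual (ultrapower U)) closure_of
      (canonical_embedding (ultrapower U) ` set_ultrapower U B)"
    and far: "\<And>S k. S \<in> vcarrier (ultrapower U) \<Longrightarrow> k \<in> unit_ball (bidual (ultrapower U)) \<Longrightarrow>
      h \<noteq> vadd (bidual (ultrapower U)) (canonical_embedding (ultrapower U) S)
        (vscale (bidual (ultrapower U)) \<epsilon> k)"
    using nwc unfolding weakly_compact_up_to_def by blast
  have hD: "h \<in> vcarrier (bidual (ultrapower U))"
    using h unfolding in_closure_of by (simp add: weak_star_def)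
  have "\<exists>f. f \<in> unit_ball (dual (ultrapower U)) \<and> \<epsilon> < \<bar>h f - f (ultraclass U z)\<bar>" for z
  proof (rule ccontr)
    assume "\<not> ?thesis"
    then have "\<bar>h f - f (ultraclass U z)\<bar> \<le> \<epsilon>" if "f \<in> unit_ball (dual (ultrapower U))" for f
      using that by force
    then obtain k where "k \<in> unit_ball (bidual (ultrapower U))"
      "h = vadd (bidual (ultrapower U)) (canonical_embedding (ultrapower U) (ultraclass U z))
         (vscale (bidual (ultrapower U)) \<epsilon> k)"
      using bidual_ultrapower_rescale[OF hD ne \<epsilon>] by blast
    then show False
      using far[of "ultraclass U z" k] by (simp add: vcarrier_ultrapower)
  qed
  then obtain f where f: "\<And>z. f z \<in> unit_ball (dual (ultrapower U))"
    and f_far: "\<And>z. \<epsilon> < \<bar>h (f z) - f z (ultraclass U z)\<bar>"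
    by metis
  define \<sigma> where "\<sigma> z = (if f z (ultraclass U z) \<le> h (f z) then 1 else - 1 :: real)" for z
  define \<psi> where "\<psi> z x = \<sigma> z * f z (ultraclass U x)" for z x
  define t where "t z = \<sigma> z * h (f z)" for z
  show thesis
  proof (rule that[of \<psi> t])
    show "\<psi> z \<in> asymptotic_functionals U" for z
      using dual_unit_ball_asymptotic[OF ne f[of z]]
        asymptotic_functionals_uminus[OF dual_unit_ball_asymptotic[OF ne f[of z]]]
      by (simp add: \<psi>_def[abs_def] \<sigma>_def)
    show "\<epsilon> < t z - \<psi> z z" for z
      using f_far[of z] by (auto simp: \<psi>_def t_def \<sigma>_def)
    fix T :: "(nat \<Rightarrow>\<^sub>C 'a) set" and \<eta> :: real
    assume T: "finite T" "\<eta> > 0"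
    then have "finite (f ` T)" "f ` T \<subseteq> vcarrier (dual (ultrapower U))"
      using f by (auto simp: unit_ball_def)
    then obtain g where g: "g \<in> canonical_embedding (ultrapower U) ` set_ultrapower U B"
      "\<And>k. k \<in> f ` T \<Longrightarrow> \<bar>g k - h k\<bar> < \<eta>"
      using weak_star_approximation[OF h _ _ T(2)] by blast
    then obtain x where x: "\<forall>p. apply_bcontfun x p \<in> B"
      "g = canonical_embedding (ultrapower U) (ultraclass U x)"
      by (auto simp: set_ultrapower_def)
    have "\<bar>\<psi> z x - t z\<bar> < \<eta>" if "z \<in> T" for z
    proof -
      have "g (f z) = f z (ultraclass U x)"
        using f[of z] by (simp add: x(2) canonical_embedding_def unit_ball_def)
      then have "\<bar>f z (ultraclass U x) - h (f z)\<bar> < \<eta>"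
        using g(2)[of "f z"] that by simp
      then show ?thesis
        by (auto simp: \<psi>_def t_def \<sigma>_def)
    qed
    then show "\<exists>x. (\<forall>p. apply_bcontfun x p \<in> B) \<and> (\<forall>z\<in>T. \<bar>\<psi> z x - t z\<bar> < \<eta>)"
      using x(1) by blast
  qed
qed

lemma compact_finite_net:
  fixes K :: "'a::metric_space set"
  assumes "compact K" "\<eta> > 0"
  shows "\<exists>T. finite T \<and> T \<subseteq> K \<and> K \<subseteq> (\<Union>x\<in>T. ball x \<eta>)"
  using seq_compact_imp_totally_bounded[OF compact_imp_seq_compact[OF assms(1)]] assms(2) by simp

lemma compact_eventually_norm_ge:
  fixes K :: "(nat \<Rightarrow>\<^sub>C 'a::real_normed_vector) set"
  assumes "compact K" "\<eta> > 0"
    and ev: "\<And>w. w \<in> K \<Longrightarrow> eventually (\<lambda>p. c \<le> norm (apply_bcontfun w p)) U"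
  shows "eventually (\<lambda>p. \<forall>w\<in>K. c - \<eta> \<le> norm (apply_bcontfun w p)) U"
proof -
  obtain T where T: "finite T" "T \<subseteq> K" "K \<subseteq> (\<Union>x\<in>T. ball x \<eta>)"
    using compact_finite_net[OF assms(1,2)] by metis
  have "eventually (\<lambda>p. \<forall>w\<in>T. c \<le> norm (apply_bcontfun w p)) U"
    using T ev by (intro eventually_ball_finite) auto
  then show ?thesis
  proof (rule eventually_mono, intro ballI)
    fix p w assume p: "\<forall>w\<in>T. c \<le> norm (apply_bcontfun w p)" and "w \<in> K"
    then obtain v where v: "v \<in> T" "dist v w < \<eta>"
      using T(3) by auto
    have "norm (apply_bcontfun v p) \<le> norm (apply_bcontfun w p) + norm (apply_bcontfun (v - w) p)"
      using norm_triangle_ineq[of "apply_bcontfun w p" "apply_bcontfun (v - w) p"] by simp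
    moreover have "norm (apply_bcontfun (v - w) p) \<le> dist v w"
      using norm_bounded[of "v - w" p] by (simp add: dist_norm)
    ultimately show "c - \<eta> \<le> norm (apply_bcontfun w p)"
      using p v by fastforce
  qed
qed

text \<open>
  The point \<open>x\<^sub>l\<close> is chosen so that it nearly attains the values \<open>t e\<close> for all \<open>e\<close> in finite nets of the
  convex hulls of \<open>x\<^sub>0, \<dots>, x\<^sub>k\<^sub>-\<^sub>1\<close> with \<open>k \<le> l\<close>. If \<open>v\<close> is a convex combination of the points from index
  \<open>k\<close> on and \<open>u\<close> one of the points before \<open>k\<close>, with \<open>e\<close> close to \<open>u\<close>, then \<open>\<psi> e (v - e) > \<epsilon> - \<eta>\<close>, which
  keeps the coordinates of \<open>v - u\<close> away from 0 along \<open>U\<close>. The set of all these differences is convex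
  and compact, so one coordinate serves for all of them, and in this coordinate they are separated
  from 0 by a functional.
\<close>
lemma not_weakly_compact_separated_system:
  fixes B :: "'a::real_normed_vector set"
  assumes U: "free_ultrafilter U" and \<epsilon>: "\<epsilon> > 0" "\<epsilon>' < \<epsilon>"
    and nwc: "\<not> weakly_compact_up_to (ultrapower U) (set_ultrapower U B) \<epsilon>"
  shows "separated_system B \<epsilon>' n"
proof -
  have ne: "U \<noteq> bot" and ultra: "eventually P U \<or> eventually (\<lambda>i. \<not> P i) U" for P
    using U by (auto simp: free_ultrafilter_def)
  obtain \<psi> :: "(nat \<Rightarrow>\<^sub>C 'a) \<Rightarrow> (nat \<Rightarrow>\<^sub>C 'a) \<Rightarrow> real" and t
    where \<psi>: "\<And>z. \<psi> z \<in> asymptotic_functionals U" and gap: "\<And>z. \<epsilon> < t z - \<psi> z z"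
    and approx: "\<And>T \<eta>. finite T \<Longrightarrow> \<eta> > 0 \<Longrightarrow>
       \<exists>x. (\<forall>p. apply_bcontfun x p \<in> B) \<and> (\<forall>z\<in>T. \<bar>\<psi> z x - t z\<bar> < \<eta>)"
    using not_weakly_compact_witnesses[OF U \<epsilon>(1) nwc] by blast
  have lin: "linear (\<psi> z)" for z
    using \<psi> by (simp add: asymptotic_functionals_def)
  \<comment> \<open>The parameter \<open>\<eta>\<close> is spent three times: in the approximation of \<open>t e\<close>, on the net in the earlier
    hull, and on the net in the set of differences.\<close>
  define \<eta> where "\<eta> = (\<epsilon> - \<epsilon>') / 3"
  have \<eta>: "\<eta> > 0"
    using \<epsilon>(2) by (simp add: \<eta>_def)
  have "\<exists>T. finite T \<and> convex hull S \<subseteq> (\<Union>z\<in>T. ball z \<eta>)" if "finite S" for S :: "(nat \<Rightarrow>\<^sub>C 'a) set"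
    using compact_finite_net[OF finite_imp_compact_convex_hull[OF that] \<eta>] by metis
  then obtain net where net: "\<And>S :: (nat \<Rightarrow>\<^sub>C 'a) set. finite S \<Longrightarrow> finite (net S)"
    "\<And>S :: (nat \<Rightarrow>\<^sub>C 'a) set. finite S \<Longrightarrow> convex hull S \<subseteq> (\<Union>z\<in>net S. ball z \<eta>)"
    by metis
  define good where "good f l r \<longleftrightarrow> (\<forall>p. apply_bcontfun r p \<in> B) \<and>
      (\<forall>k\<le>l. \<forall>z\<in>net (f ` {..<k}). \<bar>\<psi> z r - t z\<bar> < \<eta>)" for f :: "nat \<Rightarrow> (nat \<Rightarrow>\<^sub>C 'a)" and l :: nat and r
  have "\<exists>x. \<forall>l. good x l (x l)"
  proof (rule dependent_wellorder_choice)
    fix r and f g :: "nat \<Rightarrow> (nat \<Rightarrow>\<^sub>C 'a)" and l :: nat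
    assume "\<And>y. y < l \<Longrightarrow> f y = g y"
    then have "f ` {..<k} = g ` {..<k}" if "k \<le> l" for k
      using that by (intro image_cong) auto
    then show "good f l r = good g l r"
      by (simp add: good_def)
  next
    fix l :: nat and f :: "nat \<Rightarrow> (nat \<Rightarrow>\<^sub>C 'a)"
    have "finite (\<Union>k\<le>l. net (f ` {..<k}))"
      using net(1) by simp
    then show "\<exists>r. good f l r"
      using approx[OF _ \<eta>, of "\<Union>k\<le>l. net (f ` {..<k})"] unfolding good_def by fastforce
  qed
  then obtain x where x: "\<And>l. good x l (x l)"
    by blast
  define K where "K k = (\<Union>v\<in>convex hull (x ` {k..<n}). \<Union>u\<in>convex hull (x ` {..<k}). {v - u})" for k
  have K: "compact (K k)" "convex (K k)" for k
    unfolding K_def by (intro compact_differences' convex_differences finite_imp_compact_convex_hull; simp)+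
  have "eventually (\<lambda>p. \<epsilon> - 2 * \<eta> \<le> norm (apply_bcontfun w p)) U" if w: "w \<in> K k" for k w
  proof -
    obtain u v where u: "u \<in> convex hull (x ` {..<k})" and v: "v \<in> convex hull (x ` {k..<n})"
      and w: "w = v - u"
      using w by (auto simp: K_def)
    obtain e where e: "e \<in> net (x ` {..<k})" "dist e u < \<eta>"
      using net(2)[of "x ` {..<k}"] u by auto
    have "convex {z. t e - \<eta> \<le> \<psi> e z}"
    proof (rule convexI)
      fix a b :: "nat \<Rightarrow>\<^sub>C 'a" and s r :: real
      assume "a \<in> {z. t e - \<eta> \<le> \<psi> e z}" "b \<in> {z. t e - \<eta> \<le> \<psi> e z}" "0 \<le> s" "0 \<le> r" "s + r = 1"
      then have "s * (t e - \<eta>) + r * (t e - \<eta>) \<le> s * \<psi> e a + r * \<psi> e b"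
        by (intro add_mono mult_left_mono) auto
      then show "s *\<^sub>R a + r *\<^sub>R b \<in> {z. t e - \<eta> \<le> \<psi> e z}"
        using \<open>s + r = 1\<close> by (simp add: linear_add[OF lin] linear_scale[OF lin] flip: distrib_right)
    qed
    moreover have "x ` {k..<n} \<subseteq> {z. t e - \<eta> \<le> \<psi> e z}"
      using x e(1) by (force simp: good_def abs_less_iff)
    ultimately have "v \<in> {z. t e - \<eta> \<le> \<psi> e z}"
      using v hull_minimal[of _ _ convex] by blast
    then have "\<epsilon> - \<eta> < \<psi> e (v - e)"
      using gap[of e] linear_diff[OF lin, of e v e] by simp
    then have "\<not> eventually (\<lambda>p. norm (apply_bcontfun (v - e) p) \<le> \<epsilon> - \<eta>) U"
      using asymptotic_functionals_le[OF \<psi>[of e], of "v - e" "\<epsilon> - \<eta>"] by linarith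
    then have "eventually (\<lambda>p. \<not> norm (apply_bcontfun (v - e) p) \<le> \<epsilon> - \<eta>) U"
      using ultra by blast
    then show ?thesis
    proof (rule eventually_mono)
      fix p assume "\<not> norm (apply_bcontfun (v - e) p) \<le> \<epsilon> - \<eta>"
      moreover have "norm (apply_bcontfun (v - e) p) \<le> norm (apply_bcontfun w p) + norm (apply_bcontfun (u - e) p)"
        using norm_triangle_ineq[of "apply_bcontfun w p" "apply_bcontfun (u - e) p"] by (simp add: w)
      moreover have "norm (apply_bcontfun (u - e) p) \<le> dist e u"
        using norm_bounded[of "u - e" p] by (simp add: dist_norm norm_minus_commute)
      ultimately show "\<epsilon> - 2 * \<eta> \<le> norm (apply_bcontfun w p)"
        using e(2) by simp
    qed
  qed
  then have "eventually (\<lambda>p. \<forall>w\<in>K k. \<epsilon> - 2 * \<eta> - \<eta> \<le> norm (apply_bcontfun w p)) U" for k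
    by (intro compact_eventually_norm_ge K \<eta>)
  then have "eventually (\<lambda>p. \<forall>k\<in>{..<n}. \<forall>w\<in>K k. \<epsilon> - 2 * \<eta> - \<eta> \<le> norm (apply_bcontfun w p)) U"
    by (intro eventually_ball_finite) auto
  then obtain p where p: "\<And>k w. k < n \<Longrightarrow> w \<in> K k \<Longrightarrow> \<epsilon> - 2 * \<eta> - \<eta> \<le> norm (apply_bcontfun w p)"
    using eventually_happens'[OF ne] by blast
  have \<epsilon>': "\<epsilon> - 2 * \<eta> - \<eta> = \<epsilon>'"
    by (simp add: \<eta>_def field_simps)
  have eval: "linear (\<lambda>w :: nat \<Rightarrow>\<^sub>C 'a. apply_bcontfun w p)"
    by (rule linearI) simp_all
  have "\<exists>f. f \<in> unit_functionals \<and> (\<forall>w\<in>K k. \<epsilon>' \<le> f (apply_bcontfun w p))" if k: "k < n" for k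
  proof (cases "K k = {}")
    case True
    then show ?thesis
      by (intro exI[of _ "\<lambda>_. 0"]) (simp add: unit_functionals_def linear_zero)
  next
    case False
    have "convex ((\<lambda>w. apply_bcontfun w p) ` K k)"
      by (rule convex_linear_image[OF eval K(2)])
    moreover have "(\<lambda>w. apply_bcontfun w p) ` K k \<noteq> {}"
      using False by simp
    moreover have "\<epsilon>' \<le> norm c" if "c \<in> (\<lambda>w. apply_bcontfun w p) ` K k" for c
      using that p[OF k] \<epsilon>' by auto
    ultimately obtain f where "f \<in> unit_functionals"
      "\<And>c. c \<in> (\<lambda>w. apply_bcontfun w p) ` K k \<Longrightarrow> \<epsilon>' \<le> f c"
      using convex_away_from_zero_functional by blast
    then show ?thesis
      by blast
  qed
  then obtain f where f: "\<And>k. k < n \<Longrightarrow> f k \<in> unit_functionals"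
    and f_sep: "\<And>k w. k < n \<Longrightarrow> w \<in> K k \<Longrightarrow> \<epsilon>' \<le> f k (apply_bcontfun w p)"
    by metis
  have "\<epsilon>' \<le> f k (apply_bcontfun (x l) p) - f k (apply_bcontfun (x i) p)" if "i < k" "k \<le> l" "l < n" for i k l
  proof -
    have "x l - x i \<in> K k"
    proof -
      have "x l \<in> convex hull (x ` {k..<n})" "x i \<in> convex hull (x ` {..<k})"
        using that by (auto intro: hull_inc)
      then show ?thesis
        unfolding K_def by blast
    qed
    moreover have "linear (f k)"
      using f[of k] that by (simp add: unit_functionals_def)
    ultimately show ?thesis
      using f_sep[of k "x l - x i"] that by (simp add: linear_diff)
  qed
  then show ?thesis
    unfolding separated_system_def using x f
    by (intro exI[of _ "\<lambda>i. apply_bcontfun (x i) p"] exI[of _ f]) (simp add: good_def)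
qed

section \<open>Comparison of the two measures\<close>

text \<open>
  A separated pair with gap \<open>3R\<close> cannot lie in a set bounded by \<open>R\<close>. Consequently the infimum
  defining \<open>gamma_wc\<close> is taken over a nonempty set.
\<close>
lemma bounded_weakly_compact_up_to:
  fixes B :: "'a::real_normed_vector set"
  assumes U: "free_ultrafilter U" and "bounded B"
  shows "\<exists>\<epsilon>>0. weakly_compact_up_to (ultrapower U) (set_ultrapower U B) \<epsilon>"
proof -
  obtain R where R: "R > 0" "\<And>b. b \<in> B \<Longrightarrow> norm b \<le> R"
    using assms(2) unfolding bounded_pos by blast
  have "weakly_compact_up_to (ultrapower U) (set_ultrapower U B) (4 * R)"
  proof (rule ccontr)
    assume "\<not> ?thesis"
    then have "separated_system B (3 * R) 2"
      using R(1) by (intro not_weakly_compact_separated_system[OF U, of "4 * R"]) auto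
    then obtain x :: "nat \<Rightarrow> 'a" and f where x: "\<forall>i<2. x i \<in> B \<and> f i \<in> unit_functionals"
      and sep: "\<forall>i k l. i < k \<longrightarrow> k \<le> l \<longrightarrow> l < 2 \<longrightarrow> 3 * R \<le> f k (x l) - f k (x i)"
      unfolding separated_system_def by blast
    have "3 * R \<le> f 1 (x 1) - f 1 (x 0)"
      using sep by simp
    moreover have "\<bar>f 1 (x 1)\<bar> \<le> R" "\<bar>f 1 (x 0)\<bar> \<le> R"
      using x unit_functionals_bound[OF _ R(2)] by simp_all
    ultimately show False
      using R(1) by linarith
  qed
  then show ?thesis
    using R(1) by (intro exI[of _ "4 * R"]) simp
qed

lemma gamma_wc_convex_hull_le:
  fixes A :: "'a::real_normed_vector set"
  assumes "bounded A" and U: "free_ultrafilter U"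
  shows "gamma_wc (ultrapower U) (set_ultrapower U (convex hull A))
           \<le> 2 * gamma_wc (ultrapower U) (set_ultrapower U A)"
proof (rule ccontr)
  let ?g = "\<lambda>B. gamma_wc (ultrapower U) (set_ultrapower U B)"
  assume "\<not> ?thesis"
  then have "?g A < ?g (convex hull A) / 2"
    by simp
  then obtain \<delta> where \<delta>: "\<delta> > 0" "weakly_compact_up_to (ultrapower U) (set_ultrapower U A) \<delta>"
    and less: "2 * \<delta> < ?g (convex hull A)"
    using bounded_weakly_compact_up_to[OF U assms(1)]
      cInf_lessD[of "{\<epsilon>. \<epsilon> > 0 \<and> weakly_compact_up_to (ultrapower U) (set_ultrapower U A) \<epsilon>}"]
    unfolding gamma_wc_alt[of _ "set_ultrapower U A"] by fastforce
  obtain \<epsilon> where \<epsilon>: "2 * \<delta> < \<epsilon>" "\<epsilon> < ?g (convex hull A)"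
    using less dense by blast
  have "\<not> weakly_compact_up_to (ultrapower U) (set_ultrapower U (convex hull A)) \<epsilon>"
  proof
    assume "weakly_compact_up_to (ultrapower U) (set_ultrapower U (convex hull A)) \<epsilon>"
    then have "?g (convex hull A) \<le> \<epsilon>"
      unfolding gamma_wc_alt using \<delta>(1) \<epsilon>(1) by (intro cInf_lower bdd_belowI[of _ 0]) auto
    then show False
      using \<epsilon>(2) by simp
  qed
  \<comment> \<open>One \<open>\<eta>\<close> is lost in finding the system in the convex hull and four in passing to \<open>A\<close>.\<close>
  define \<eta> where "\<eta> = (\<epsilon> - 2 * \<delta>) / 8"
  have \<eta>: "\<eta> > 0" "\<eta> \<le> \<epsilon> - \<eta>" "2 * \<delta> < (\<epsilon> - \<eta>) - 4 * \<eta>"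
    using \<epsilon>(1) \<delta>(1) by (auto simp: \<eta>_def field_simps)
  have "separated_system (convex hull A) (\<epsilon> - \<eta>) n" for n
    using \<open>\<not> weakly_compact_up_to _ _ \<epsilon>\<close> \<epsilon>(1) \<delta>(1) \<eta>(1)
    by (intro not_weakly_compact_separated_system[OF U, of \<epsilon>]) auto
  then have "separated_system A ((\<epsilon> - \<eta>) - 4 * \<eta>) n" for n
    using \<eta> by (intro separated_system_convex_hull[OF assms(1)])
  then have "(\<epsilon> - \<eta>) - 4 * \<eta> \<le> 2 * \<delta>"
    using \<delta> by (intro separated_system_not_weakly_compact[OF U assms(1)])
  then show False
    using \<eta>(3) by simp
qed

theorem theorem6p7:
  fixes A :: "'a::banach set" and U :: "nat filter"
  assumes "A \<noteq> {}" and "bounded A" and "free_ultrafilter U"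
  shows "gamma_wc (ultrapower U) (set_ultrapower U (convex hull A))
           \<le> 4 * gamma_wc (ultrapower U) (set_ultrapower U A)"
proof -
  have "0 \<le> gamma_wc (ultrapower U) (set_ultrapower U A)"
    unfolding gamma_wc_alt using bounded_weakly_compact_up_to[OF assms(3,2)]
    by (intro cInf_greatest) auto
  then show ?thesis
    using gamma_wc_convex_hull_le[OF assms(2,3)] by simp
qed

end
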